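(* Consider the discrete-approximation problem (PDA) of the context. Let $W_k$ ($k\in I$) and $q$ be continuous convex functions, and let $f(\cdot,t)$ ($t=2\delta,3\delta,\dots,1-2\delta$) be continuously differentiable proper functions, convex with respect to $x$. Besides, let $f(\cdot,t)$ be continuous at the points of some feasible trajectory. Then, for optimality of the feasible trajectory $\{\tilde x(t)\}$, $t=0,\delta,\dots,1$, in (PDA) it is necessary that there exist numbers $\mu=\mu_\delta\in\{0,1\}$, $\alpha_k(t)\ge0$, $k\in I(\tilde x(t),\Delta\tilde x(t),\Delta^2\tilde x(t))$, and a pair of $\mathbb{R}^n$-valued grid functions $\{x^*(t),u^*(t)\}$, not all equal to zero at the same time, satisfying for $t=2\delta,3\delta,\dots,1-2\delta$ $$\Bigl[\tfrac1{\delta^2}\bigl(x^*(t)-u^*(t)+u^*(t+\delta)-x^*(t+2\delta)-\mu\delta f_x'(\tilde x(t),t)\bigr),\ \tfrac1\delta\bigl(u^*(t+\delta)-2x^*(t+2\delta)\bigr),\ -x^*(t+2\delta)\Bigr]$$ $$\in\sum_{k\in I(\tilde x(t),\Delta\tilde x(t),\Delta^2\tilde x(t))}\alpha_k(t)\,\partial_{(x,v_1,v_2)}W_k(\tilde x(t),\Delta\tilde x(t),\Delta^2\tilde x(t)),$$ $$\alpha_k(t)W_k(\tilde x(t),\Delta\tilde x(t),\Delta^2\tilde x(t))=0,\qquad \alpha_k(t)\ge0,$$ and the boundary condition $$x^*(1-\delta)-u^*(1-\delta)\in\mu\,\partial q(\tilde x(1-\delta)),\qquad x^*(1)=0.$$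 In addition, under the non-degeneracy condition (see context), these conditions are sufficient for optimality of $\{\tilde x(t)\}$.
   Context: Let $\delta>0$ be the step of a uniform grid $0,\delta,2\delta,\dots,1$ on $[0,1]$. For a grid function $x(t)\in\mathbb{R}^n$ put $\Delta x(t)=\frac1\delta[x(t+\delta)-x(t)]$ and $\Delta^2x(t)=\frac1\delta[\Delta x(t+\delta)-\Delta x(t)]$, $t=0,\delta,\dots,1-2\delta$. Problem (PDA): minimize $J_\delta[x(\cdot)]=\sum_{t=2\delta,\dots,1-2\delta}\delta f(x(t),t)+q(x(1-\delta))$ subject to $W_k(x(t),\Delta x(t),\Delta^2x(t))\le0$, $t=0,\delta,\dots,1-2\delta$, $k\in I=\{1,\dots,m\}$, and $x(0)=\upsilon_0$, $\Delta x(0)=\upsilon_1$ (equivalently $x(\delta)=\upsilon_0+\delta\upsilon_1$), where $\upsilon_0,\upsilon_1\in\mathbb{R}^n$ are fixed and $W_k:\mathbb{R}^{3n}\to\mathbb{R}$. Equivalently the constraints are $\Phi_k(x(t),x(t+\delta),x(t+2\delta))\le0$ with $\Phi_k(x,v_1,v_2)=W_k\bigl[x,\frac1\delta(v_1-x),\frac1{\delta^2}(v_2-2v_1+x)\bigr]$. Feasible trajectories are grid functions satisfying the constraints; optimal means minimizing $J_\delta$ among them. $\partial$ is the convex subdifferential, $\partial_{(x,v_1,v_2)}$ being taken in all arguments. A proper function does not take the value $-\infty$ and is not identically $+\infty$. $I(x,v_1,v_2)=\{k\in I:W_k(x,v_1,v_2)=0\}$; an empty sum of sets is $\{0\}$.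 Non-degeneracy condition for (PDA): with $F_\delta=\{(x,v_1,v_2):\Phi_k(x,v_1,v_2)\le0,\ k\in I\}$ there are points $x^0(t)\in\mathbb{R}^n$ such that one of the following holds: (1) $(x^0(t),x^0(t+\delta),x^0(t+2\delta))\in\operatorname{ri}F_\delta$ and $x^0(t)\in\operatorname{ri}(\operatorname{dom}f(\cdot,t))$, $t=0,\delta,\dots,1-2\delta$; (2) $(x^0(t),x^0(t+\delta),x^0(t+2\delta))\in\operatorname{int}F_\delta$ (with the possible exception of one fixed $t_0$) and $f(\cdot,t)$ are continuous at $x^0(t)$. Convention: $f(\cdot,0)\equiv f(\cdot,\delta)\equiv0$.
   Formalization: The inclusion is required also at t=0 and t=δ (with f=0 there), non-triviality counts x*(t), u*(t) only for t≥2δ, and sufficiency is claimed only for μ=1; as literally stated, sufficiency fails (e.g. W_1=-1, f=0, q(x)=x, δ=1/4). *)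

theory Defs
  imports "HOL-Analysis.Analysis"
begin

section \<open>Convex analysis\<close>

definition subdifferential :: "('a::real_inner \<Rightarrow> real) \<Rightarrow> 'a \<Rightarrow> 'a set" where
  "subdifferential \<phi> x = {g. \<forall>y. \<phi> y \<ge> \<phi> x + g \<bullet> (y - x)}"

definition effective_domain :: "('a \<Rightarrow> ereal) \<Rightarrow> 'a set" where
  "effective_domain \<phi> = {x. \<phi> x < \<infinity>}"

definition proper_fun :: "('a \<Rightarrow> ereal) \<Rightarrow> bool" where
  "proper_fun \<phi> \<longleftrightarrow> (\<forall>x. \<phi> x \<noteq> -\<infinity>) \<and> (\<exists>x. \<phi> x \<noteq> \<infinity>)"

definition convex_fun :: "('a::real_vector \<Rightarrow> ereal) \<Rightarrow> bool" where
  "convex_fun \<phi> \<longleftrightarrow> convex {(x, r). \<phi> x \<le> ereal r}"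

(* Continuity in the sense of convex analysis: an extended-real function that is
   identically infinite near x is not counted as continuous at x. *)
definition continuous_at_pt :: "('a::t2_space \<Rightarrow> ereal) \<Rightarrow> 'a \<Rightarrow> bool" where
  "continuous_at_pt \<phi> x \<longleftrightarrow> \<bar>\<phi> x\<bar> \<noteq> \<infinity> \<and> isCont \<phi> x"

(* Differentiability presupposes finiteness in a neighbourhood of x. *)
definition has_gradient :: "('a::real_inner \<Rightarrow> ereal) \<Rightarrow> 'a \<Rightarrow> 'a \<Rightarrow> bool" where
  "has_gradient \<phi> x g \<longleftrightarrow>
     x \<in> interior {y. \<bar>\<phi> y\<bar> \<noteq> \<infinity>} \<and> GDERIV (\<lambda>y. real_of_ereal (\<phi> y)) x :> g"

definition continuously_differentiable :: "('a::real_inner \<Rightarrow> ereal) \<Rightarrow> bool" where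
  "continuously_differentiable \<phi> \<longleftrightarrow>
     (\<exists>g. (\<forall>x\<in>effective_domain \<phi>. has_gradient \<phi> x (g x)) \<and>
          continuous_on (effective_domain \<phi>) g)"


section \<open>The discrete-approximation problem\<close>

(* The grid has N steps of length \<delta> = 1 / N.  The grid point t = i * \<delta> is represented
   by its index i, so a grid function is a map nat \<Rightarrow> 'a of which only the values
   at 0, ..., N matter, 1 corresponds to N and 1 - 2 * \<delta> to N - 2. *)

definition diff1 :: "real \<Rightarrow> (nat \<Rightarrow> 'a::real_vector) \<Rightarrow> nat \<Rightarrow> 'a" where
  "diff1 \<delta> x i = (1 / \<delta>) *\<^sub>R (x (i + 1) - x i)"

definition diff2 :: "real \<Rightarrow> (nat \<Rightarrow> 'a::real_vector) \<Rightarrow> nat \<Rightarrow> 'a" where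
  "diff2 \<delta> x i = (1 / \<delta>) *\<^sub>R (diff1 \<delta> x (i + 1) - diff1 \<delta> x i)"

definition diff_point :: "real \<Rightarrow> (nat \<Rightarrow> 'a::real_vector) \<Rightarrow> nat \<Rightarrow> 'a \<times> 'a \<times> 'a" where
  "diff_point \<delta> x i = (x i, diff1 \<delta> x i, diff2 \<delta> x i)"

definition pda_cost ::
    "nat \<Rightarrow> real \<Rightarrow> ('a \<Rightarrow> nat \<Rightarrow> ereal) \<Rightarrow> ('a \<Rightarrow> real) \<Rightarrow> (nat \<Rightarrow> 'a) \<Rightarrow> ereal" where
  "pda_cost N \<delta> f q x = (\<Sum>i=2..N-2. ereal \<delta> * f (x i) i) + ereal (q (x (N - 1)))"

definition pda_feasible ::
    "nat \<Rightarrow> real \<Rightarrow> nat \<Rightarrow> (nat \<Rightarrow> 'a \<times> 'a \<times> 'a \<Rightarrow> real) \<Rightarrow> 'a \<Rightarrow> 'a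
      \<Rightarrow> (nat \<Rightarrow> 'a::real_vector) \<Rightarrow> bool" where
  "pda_feasible N \<delta> m W \<upsilon>0 \<upsilon>1 x \<longleftrightarrow>
     (\<forall>i\<in>{0..N-2}. \<forall>k\<in>{1..m}. W k (diff_point \<delta> x i) \<le> 0) \<and>
     x 0 = \<upsilon>0 \<and> diff1 \<delta> x 0 = \<upsilon>1"

definition pda_optimal ::
    "nat \<Rightarrow> real \<Rightarrow> nat \<Rightarrow> (nat \<Rightarrow> 'a \<times> 'a \<times> 'a \<Rightarrow> real) \<Rightarrow> ('a \<Rightarrow> nat \<Rightarrow> ereal)
      \<Rightarrow> ('a \<Rightarrow> real) \<Rightarrow> 'a \<Rightarrow> 'a \<Rightarrow> (nat \<Rightarrow> 'a::real_vector) \<Rightarrow> bool" where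
  "pda_optimal N \<delta> m W f q \<upsilon>0 \<upsilon>1 x \<longleftrightarrow>
     pda_feasible N \<delta> m W \<upsilon>0 \<upsilon>1 x \<and>
     (\<forall>y. pda_feasible N \<delta> m W \<upsilon>0 \<upsilon>1 y \<longrightarrow> pda_cost N \<delta> f q x \<le> pda_cost N \<delta> f q y)"

definition active_set ::
    "nat \<Rightarrow> (nat \<Rightarrow> 'b \<Rightarrow> real) \<Rightarrow> 'b \<Rightarrow> nat set" where
  "active_set m W p = {k\<in>{1..m}. W k p = 0}"

definition \<Phi> :: "real \<Rightarrow> ('a \<times> 'a \<times> 'a \<Rightarrow> real) \<Rightarrow> 'a::real_vector \<times> 'a \<times> 'a \<Rightarrow> real" where
  "\<Phi> \<delta> w = (\<lambda>(x, v1, v2).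
     w (x, (1 / \<delta>) *\<^sub>R (v1 - x), (1 / \<delta>\<^sup>2) *\<^sub>R (v2 - 2 *\<^sub>R v1 + x)))"

definition constraint_set ::
    "real \<Rightarrow> nat \<Rightarrow> (nat \<Rightarrow> 'a \<times> 'a \<times> 'a \<Rightarrow> real) \<Rightarrow> ('a::real_vector \<times> 'a \<times> 'a) set" where
  "constraint_set \<delta> m W = {p. \<forall>k\<in>{1..m}. \<Phi> \<delta> (W k) p \<le> 0}"

definition pda_nondegenerate ::
    "nat \<Rightarrow> real \<Rightarrow> nat \<Rightarrow> (nat \<Rightarrow> 'a \<times> 'a \<times> 'a \<Rightarrow> real) \<Rightarrow> ('a::euclidean_space \<Rightarrow> nat \<Rightarrow> ereal)
      \<Rightarrow> bool" where
  "pda_nondegenerate N \<delta> m W f \<longleftrightarrow>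
     (\<exists>x0 :: nat \<Rightarrow> 'a.
        (\<forall>i\<in>{0..N-2}.
            (x0 i, x0 (i + 1), x0 (i + 2)) \<in> rel_interior (constraint_set \<delta> m W) \<and>
            x0 i \<in> rel_interior (effective_domain (\<lambda>x. f x i)))
      \<or> ((\<exists>i0. \<forall>i\<in>{0..N-2} - {i0}.
            (x0 i, x0 (i + 1), x0 (i + 2)) \<in> interior (constraint_set \<delta> m W)) \<and>
        (\<forall>i\<in>{0..N-2}. continuous_at_pt (\<lambda>x. f x i) (x0 i))))"

(* The adjoint inclusion is imposed at every grid point carrying a constraint, that is
   also at i = 0 and i = 1, where the cost term vanishes by the convention f x 0 = f x 1 = 0:
   these two inclusions link the multipliers of the first two constraints to
   xs 2, us 2, xs 3, which would otherwise be unrestricted.  The sums are Minkowski sums,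
   an empty one being {0}.  The condition \<alpha> i k * W k _ = 0 for all k
   says that multipliers of inactive constraints are 0. *)
definition pda_conditions ::
    "nat \<Rightarrow> real \<Rightarrow> nat \<Rightarrow> (nat \<Rightarrow> 'a \<times> 'a \<times> 'a \<Rightarrow> real) \<Rightarrow> ('a \<Rightarrow> nat \<Rightarrow> ereal)
      \<Rightarrow> ('a \<Rightarrow> real) \<Rightarrow> (nat \<Rightarrow> 'a::euclidean_space)
      \<Rightarrow> real \<Rightarrow> (nat \<Rightarrow> nat \<Rightarrow> real) \<Rightarrow> (nat \<Rightarrow> 'a) \<Rightarrow> (nat \<Rightarrow> 'a) \<Rightarrow> bool" where
  "pda_conditions N \<delta> m W f q x \<mu> \<alpha> xs us \<longleftrightarrow>
     (\<forall>i\<in>{0..N-2}.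
        (\<exists>f'. has_gradient (\<lambda>y. f y i) (x i) f' \<and>
           ((1 / \<delta>\<^sup>2) *\<^sub>R (xs i - us i + us (i + 1) - xs (i + 2) - (\<mu> * \<delta>) *\<^sub>R f'),
            (1 / \<delta>) *\<^sub>R (us (i + 1) - 2 *\<^sub>R xs (i + 2)),
            - xs (i + 2))
           \<in> (\<Sum>k\<in>active_set m W (diff_point \<delta> x i).
                 (\<lambda>p. \<alpha> i k *\<^sub>R p) ` subdifferential (W k) (diff_point \<delta> x i))) \<and>
        (\<forall>k\<in>{1..m}. \<alpha> i k * W k (diff_point \<delta> x i) = 0 \<and> \<alpha> i k \<ge> 0)) \<and>
     xs (N - 1) - us (N - 1) \<in> (\<lambda>p. \<mu> *\<^sub>R p) ` subdifferential q (x (N - 1)) \<and>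
     xs N = 0"

(* xs i and us i for i < 2 are left out: xs 0 and us 0 enter the conditions only through
   xs 0 - us 0, so counting them would let xs 0 = us 0 \<noteq> 0 satisfy the requirement
   without any restriction on the trajectory. *)
definition pda_nontrivial ::
    "nat \<Rightarrow> nat \<Rightarrow> real \<Rightarrow> (nat \<Rightarrow> nat \<Rightarrow> real) \<Rightarrow> (nat \<Rightarrow> 'a::zero) \<Rightarrow> (nat \<Rightarrow> 'a) \<Rightarrow> bool" where
  "pda_nontrivial N m \<mu> \<alpha> xs us \<longleftrightarrow>
     \<mu> \<noteq> 0 \<or> (\<exists>i\<in>{0..N-2}. \<exists>k\<in>{1..m}. \<alpha> i k \<noteq> 0) \<or>
     (\<exists>i\<in>{2..N}. xs i \<noteq> 0) \<or> (\<exists>i\<in>{2..N-1}. us i \<noteq> 0)"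

end

theory Submission
  imports Defs
begin

text \<open>
  Both halves rest on one identity, a second-order summation by parts (lemma
  \<open>adjoint_identity\<close>). Pair the left-hand sides of the adjoint inclusions with the difference
  points of a variation \<open>w\<close> that vanishes at the first two grid points, and sum over the grid. What
  remains is a combination of the values of \<open>w\<close>: up to a constant factor, its coefficients at the
  interior points are the gradients of the \<open>f\<close>-terms, and the last two are the quantities in the
  boundary condition.

  \<^emph>\<open>Necessity.\<close> Let \<open>s\<close> be optimal, and consider the grid functions of finite cost with the same
  first two values. None of them costs less than \<open>s\<close> while making all constraints negative. The
  theorem of the alternative for convexlike families (\<open>convexlike_alternative\<close>) converts this into
  multipliers, not all zero, for which \<open>s\<close> minimizes the Lagrangian. The terms of the Lagrangian are
  then replaced by their linearizations at \<open>s\<close>, and \<open>s\<close> stays minimal: first all \<open>f\<close>-terms, by their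
  gradients, using difference quotients along segments
  (\<open>linearize_smooth_terms\<close>); then \<open>q\<close> and the constraint functions, one at a time, by a subgradient
  that a separating hyperplane provides (\<open>linearize_convex_term\<close>). The end result is a linear
  functional of the variation that is never negative, hence zero. The last two components of the
  inclusion leave no choice for \<open>x\<^sup>*\<close> and \<open>u\<^sup>*\<close> beyond the first grid points; with them the
  identity expresses the functional through the defects of the remaining equations, and variations
  supported at a single grid point show that each defect vanishes.

  The number of grid points is a variable, so grid functions do not form a Euclidean space. For this
  reason the domain of optimization is a bare set in the multiplier and subgradient rules: convexity enters only as the existence,
  for two elements and a weight, of a third one that does at least as well as the mixture.
  Every separation takes place in the plane or in \<open>E \<times> \<real>\<close>, where \<open>E\<close> is the argument space of one
  term.

  \<^emph>\<open>Sufficiency.\<close> For a feasible \<open>y\<close> take \<open>w = y - s\<close>. By the subgradient inequality and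
  complementarity every summand of the identity is nonpositive, because a constraint function with
  a nonzero multiplier is zero along \<open>s\<close> and at most zero along \<open>y\<close>. The other side of the identity
  is a negative multiple of the linearized cost difference, which is therefore nonnegative and, by convexity,
  bounds the cost difference from below.
\<close>

section \<open>Multiplier rules for convexlike families\<close>

text \<open>The pairs that dominate a value \<open>(F x, G x)\<close> form a convex set, which misses the open negative
  quadrant; the normal of a separating line is the pair of weights. It cannot have a negative
  component, since the convex set is unbounded in both positive directions.\<close>

lemma convexlike_alternative_pair:
  fixes F G :: "'s \<Rightarrow> real"
  assumes convexlike: "\<And>x y t. \<lbrakk>x \<in> S; y \<in> S; 0 \<le> t; t \<le> 1\<rbrakk> \<Longrightarrow>
      \<exists>z\<in>S. F z \<le> (1 - t) * F x + t * F y \<and> G z \<le> (1 - t) * G x + t * G y"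
    and incompatible: "\<And>x. x \<in> S \<Longrightarrow> \<not> (F x < 0 \<and> G x < 0)"
    and nonempty: "S \<noteq> {}"
  shows "\<exists>a b. 0 \<le> a \<and> 0 \<le> b \<and> (a \<noteq> 0 \<or> b \<noteq> 0) \<and> (\<forall>x\<in>S. 0 \<le> a * F x + b * G x)"
proof -
  define C where "C = {(u, v). \<exists>x\<in>S. F x \<le> u \<and> G x \<le> v}"
  define Q where "Q = {..<0::real} \<times> {..<0::real}"
  have "convex C"
    unfolding convex_alt
  proof (intro ballI allI impI)
    fix p p' and t :: real
    assume p: "p \<in> C" "p' \<in> C" and t: "0 \<le> t \<and> t \<le> 1"
    obtain x where x: "x \<in> S" "F x \<le> fst p" "G x \<le> snd p"
      using p(1) by (auto simp: C_def)
    obtain y where y: "y \<in> S" "F y \<le> fst p'" "G y \<le> snd p'"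
      using p(2) by (auto simp: C_def)
    obtain z where z: "z \<in> S" "F z \<le> (1 - t) * F x + t * F y" "G z \<le> (1 - t) * G x + t * G y"
      using convexlike[OF x(1) y(1), of t] t by blast
    have "F z \<le> (1 - t) * fst p + t * fst p'"
      by (rule order_trans[OF z(2)]) (use x y t in \<open>intro add_mono mult_left_mono; simp\<close>)
    moreover have "G z \<le> (1 - t) * snd p + t * snd p'"
      by (rule order_trans[OF z(3)]) (use x y t in \<open>intro add_mono mult_left_mono; simp\<close>)
    ultimately show "(1 - t) *\<^sub>R p + t *\<^sub>R p' \<in> C"
      unfolding C_def using z(1) by (cases p; cases p') auto
  qed
  moreover have "convex Q"
    unfolding Q_def by (intro convex_Times convex_real_interval)
  moreover have "C \<noteq> {}"
    using nonempty by (auto simp: C_def)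
  moreover have "(-1, -1) \<in> Q"
    by (simp add: Q_def)
  moreover have "Q \<inter> C = {}"
    using incompatible by (fastforce simp: Q_def C_def)
  ultimately obtain c d where c: "c \<noteq> 0" "\<forall>p\<in>Q. c \<bullet> p \<le> d" "\<forall>p\<in>C. c \<bullet> p \<ge> d"
    using separating_hyperplane_sets[of Q C] by blast
  obtain a b where ab: "c = (a, b)"
    by (cases c)
  have Qd: "a * u + b * v \<le> d" if "u < 0" "v < 0" for u v
    using c(2) that by (auto simp: ab Q_def)
  have Cd: "a * u + b * v \<ge> d" if "x \<in> S" "F x \<le> u" "G x \<le> v" for u v x
    using c(3) that by (auto simp: ab C_def)
  \<comment> \<open>The corner \<open>(0, 0)\<close> is a limit of points \<open>(-e, -e)\<close> of the quadrant, at which the linear form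
    is at most \<open>d\<close>.\<close>
  have d: "d \<ge> 0"
  proof (rule ccontr)
    assume "\<not> d \<ge> 0"
    define e where "e = - d / (2 * (\<bar>a\<bar> + \<bar>b\<bar> + 1))"
    have "e > 0" "(\<bar>a\<bar> + \<bar>b\<bar> + 1) * e = - d / 2"
      using \<open>\<not> d \<ge> 0\<close> by (auto simp: e_def field_simps intro!: divide_neg_pos)
    moreover from this have "a * e \<le> \<bar>a\<bar> * e" "b * e \<le> \<bar>b\<bar> * e"
      by (simp_all add: mult_right_mono)
    moreover have "a * (- e) + b * (- e) \<le> d"
      using Qd[of "-e" "-e"] \<open>e > 0\<close> by simp
    ultimately show False
      using \<open>\<not> d \<ge> 0\<close> unfolding distrib_right mult_minus_right by linarith
  qed
  obtain x0 where x0: "x0 \<in> S"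
    using nonempty by blast
  have "a \<ge> 0"
  proof (rule ccontr)
    assume "\<not> a \<ge> 0"
    define u where "u = max (F x0) ((d - 1 - b * G x0) / a)"
    have "a * u \<le> d - 1 - b * G x0"
      using \<open>\<not> a \<ge> 0\<close> by (simp add: u_def max_def field_simps)
    then show False
      using Cd[OF x0, of u "G x0"] by (simp add: u_def)
  qed
  moreover have "b \<ge> 0"
  proof (rule ccontr)
    assume "\<not> b \<ge> 0"
    define v where "v = max (G x0) ((d - 1 - a * F x0) / b)"
    have "b * v \<le> d - 1 - a * F x0"
      using \<open>\<not> b \<ge> 0\<close> by (simp add: v_def max_def field_simps)
    then show False
      using Cd[OF x0, of "F x0" v] by (simp add: v_def)
  qed
  moreover have "a \<noteq> 0 \<or> b \<noteq> 0"
    using c(1) by (auto simp: ab zero_prod_def)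
  moreover have "\<forall>x\<in>S. 0 \<le> a * F x + b * G x"
    using Cd d by force
  ultimately show ?thesis
    by blast
qed

lemma sum_weighted_mix:
  fixes c u v :: "'j \<Rightarrow> real"
  shows "(\<Sum>j\<in>J. c j * ((1 - t) * u j + t * v j)) = (1 - t) * (\<Sum>j\<in>J. c j * u j) + t * (\<Sum>j\<in>J. c j * v j)"
  unfolding distrib_left sum.distrib sum_distrib_left by (simp only: mult.left_commute)

text \<open>The alternative of Fan, Glicksberg and Hoffman. Separation in a space with one coordinate per
  function is avoided by induction: the weights for all functions but one exist on the subset where
  that function is negative, and the pair case then balances the weighted sum against it on the
  whole set.\<close>

lemma convexlike_alternative:
  fixes h :: "'j \<Rightarrow> 's \<Rightarrow> real"
  assumes "finite J"
    and "\<And>x y t. \<lbrakk>x \<in> S; y \<in> S; 0 \<le> t; t \<le> 1\<rbrakk> \<Longrightarrow>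
      \<exists>z\<in>S. \<forall>j\<in>J. h j z \<le> (1 - t) * h j x + t * h j y"
    and "\<And>x. x \<in> S \<Longrightarrow> \<exists>j\<in>J. 0 \<le> h j x"
    and "S \<noteq> {}"
  shows "\<exists>l. (\<forall>j\<in>J. 0 \<le> l j) \<and> (\<exists>j\<in>J. l j \<noteq> 0) \<and> (\<forall>x\<in>S. 0 \<le> (\<Sum>j\<in>J. l j * h j x))"
  using assms
proof (induction J arbitrary: S rule: finite_induct)
  case empty
  then show ?case
    by blast
next
  case (insert a J)
  define T where "T = {x\<in>S. h a x < 0}"
  show ?case
  proof (cases "T = {}")
    case True
    then have "\<forall>x\<in>S. 0 \<le> (\<Sum>j\<in>insert a J. (if j = a then 1 else 0) * h j x)"
      using insert.hyps by (auto simp: T_def if_distrib[of "\<lambda>c. c * _"] cong: if_cong)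
    then show ?thesis
      by (intro exI[of _ "\<lambda>j. if j = a then 1 else 0"]) auto
  next
    case False
    have "\<exists>z\<in>T. \<forall>j\<in>J. h j z \<le> (1 - t) * h j x + t * h j y"
      if xy: "x \<in> T" "y \<in> T" and t: "0 \<le> t" "t \<le> 1" for x y t
    proof -
      obtain z where z: "z \<in> S" "\<forall>j\<in>insert a J. h j z \<le> (1 - t) * h j x + t * h j y"
        using insert.prems(1)[of x y t] xy t by (auto simp: T_def)
      have "(1 - t) * h a x + t * h a y < 0"
      proof (cases "t = 0")
        case True
        then show ?thesis using xy by (simp add: T_def)
      next
        case False
        then have "t * h a y < 0" "(1 - t) * h a x \<le> 0"
          using xy t by (auto simp: T_def mult_pos_neg mult_nonneg_nonpos)
        then show ?thesis by linarith
      qed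
      then have "z \<in> T"
        using z by (force simp: T_def)
      then show ?thesis
        using z(2) by blast
    qed
    moreover have "\<exists>j\<in>J. 0 \<le> h j x" if "x \<in> T" for x
      using insert.prems(2)[of x] that by (auto simp: T_def)
    ultimately obtain l where l: "\<forall>j\<in>J. 0 \<le> l j" "\<exists>j\<in>J. l j \<noteq> 0"
      "\<forall>x\<in>T. 0 \<le> (\<Sum>j\<in>J. l j * h j x)"
      using insert.IH[of T] False by blast
    define F where "F x = (\<Sum>j\<in>J. l j * h j x)" for x
    have "\<exists>z\<in>S. F z \<le> (1 - t) * F x + t * F y \<and> h a z \<le> (1 - t) * h a x + t * h a y"
      if xy: "x \<in> S" "y \<in> S" and t: "0 \<le> t" "t \<le> 1" for x y t
    proof -
      obtain z where z: "z \<in> S" "\<forall>j\<in>insert a J. h j z \<le> (1 - t) * h j x + t * h j y"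
        using insert.prems(1)[OF xy t] by auto
      have "F z \<le> (\<Sum>j\<in>J. l j * ((1 - t) * h j x + t * h j y))"
        unfolding F_def using z(2) l(1) by (intro sum_mono mult_left_mono) auto
      also have "\<dots> = (1 - t) * F x + t * F y"
        unfolding F_def by (rule sum_weighted_mix)
      finally show ?thesis
        using z by blast
    qed
    moreover have "\<not> (F x < 0 \<and> h a x < 0)" if "x \<in> S" for x
      using l(3) that by (auto simp: T_def F_def)
    ultimately obtain r s where rs: "0 \<le> r" "0 \<le> s" "r \<noteq> 0 \<or> s \<noteq> 0"
      "\<forall>x\<in>S. 0 \<le> r * F x + s * h a x"
      using convexlike_alternative_pair[of S F "h a"] insert.prems(3) by blast
    define k where "k j = (if j = a then s else r * l j)" for j
    have "(\<Sum>j\<in>insert a J. k j * h j x) = r * F x + s * h a x" for x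
    proof -
      have "(\<Sum>j\<in>J. k j * h j x) = (\<Sum>j\<in>J. r * (l j * h j x))"
        using insert.hyps by (intro sum.cong) (auto simp: k_def)
      then show ?thesis
        using insert.hyps by (simp add: k_def F_def sum_distrib_left)
    qed
    moreover have "\<forall>j\<in>insert a J. 0 \<le> k j"
      using rs l by (auto simp: k_def)
    moreover have "\<exists>j\<in>insert a J. k j \<noteq> 0"
      using rs(3) l(2) insert.hyps by (auto simp: k_def)
    ultimately show ?thesis
      using rs(4) by (intro exI[of _ k]) auto
  qed
qed

text \<open>The alternative applied to \<open>\<phi> - \<phi> s\<close> and the constraint functions. Evaluating the
  resulting inequality at \<open>s\<close> gives complementarity: a sum of nonpositive numbers is nonnegative.
  Dividing by a positive first weight makes it 1.\<close>

lemma fritz_john_convexlike: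
  fixes \<phi> :: "'s \<Rightarrow> real" and g :: "'j \<Rightarrow> 's \<Rightarrow> real"
  assumes fin: "finite J"
    and convexlike: "\<And>x y t. \<lbrakk>x \<in> S; y \<in> S; 0 \<le> t; t \<le> 1\<rbrakk> \<Longrightarrow>
      \<exists>z\<in>S. \<phi> z \<le> (1 - t) * \<phi> x + t * \<phi> y \<and> (\<forall>j\<in>J. g j z \<le> (1 - t) * g j x + t * g j y)"
    and s: "s \<in> S" "\<And>j. j \<in> J \<Longrightarrow> g j s \<le> 0"
    and optimal: "\<And>x. \<lbrakk>x \<in> S; \<And>j. j \<in> J \<Longrightarrow> g j x \<le> 0\<rbrakk> \<Longrightarrow> \<phi> s \<le> \<phi> x"
  shows "\<exists>\<mu>\<in>{0, 1}. \<exists>l. (\<forall>j\<in>J. 0 \<le> l j \<and> l j * g j s = 0) \<and> (\<mu> \<noteq> 0 \<or> (\<exists>j\<in>J. l j \<noteq> 0)) \<and>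
    (\<forall>x\<in>S. 0 \<le> \<mu> * (\<phi> x - \<phi> s) + (\<Sum>j\<in>J. l j * g j x))"
proof -
  \<comment> \<open>The index \<open>None\<close> stands for the objective.\<close>
  define h where "h o' x = (case o' of None \<Rightarrow> \<phi> x - \<phi> s | Some j \<Rightarrow> g j x)" for o' x
  define K where "K = insert None (Some ` J)"
  have "\<exists>z\<in>S. \<forall>j\<in>K. h j z \<le> (1 - t) * h j x + t * h j y"
    if xy: "x \<in> S" "y \<in> S" and t: "0 \<le> t" "t \<le> 1" for x y t
  proof -
    obtain z where z: "z \<in> S" "\<phi> z \<le> (1 - t) * \<phi> x + t * \<phi> y"
      "\<forall>j\<in>J. g j z \<le> (1 - t) * g j x + t * g j y"
      using convexlike[OF xy t] by blast
    then show ?thesis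
      by (intro bexI[of _ z]) (auto simp: K_def h_def algebra_simps)
  qed
  moreover have "\<exists>j\<in>K. 0 \<le> h j x" if "x \<in> S" for x
    using optimal[OF that] by (force simp: K_def h_def not_le dest: less_imp_le)
  ultimately obtain l where l: "\<forall>j\<in>K. 0 \<le> l j" "\<exists>j\<in>K. l j \<noteq> 0"
    "\<forall>x\<in>S. 0 \<le> (\<Sum>j\<in>K. l j * h j x)"
    using convexlike_alternative[of K S h] fin s(1) by (auto simp: K_def)
  define c where "c = (if l None = 0 then 1 else inverse (l None))"
  have "0 \<le> l None"
    using l(1) by (simp add: K_def)
  then have c: "c > 0" "c * l None \<in> {0, 1}"
    by (auto simp: c_def)
  define k where "k j = c * l (Some j)" for j
  have k: "\<forall>j\<in>J. 0 \<le> k j" "c * l None \<noteq> 0 \<or> (\<exists>j\<in>J. k j \<noteq> 0)"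
    using l c(1) by (auto simp: k_def K_def)
  have lag: "0 \<le> c * l None * (\<phi> x - \<phi> s) + (\<Sum>j\<in>J. k j * g j x)" if "x \<in> S" for x
  proof -
    have "(\<Sum>j\<in>K. l j * h j x) = l None * (\<phi> x - \<phi> s) + (\<Sum>j\<in>J. l (Some j) * g j x)"
      using fin by (simp add: K_def sum.reindex h_def)
    then have "c * (\<Sum>j\<in>K. l j * h j x) = c * l None * (\<phi> x - \<phi> s) + (\<Sum>j\<in>J. k j * g j x)"
      by (simp only: k_def sum_distrib_left distrib_left mult.assoc)
    then show ?thesis
      using l(3) that c(1) by (metis less_imp_le mult_nonneg_nonneg)
  qed
  have "\<forall>j\<in>J. k j * g j s = 0"
  proof -
    have nonpos: "k j * g j s \<le> 0" if "j \<in> J" for j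
      using k(1) s(2) that by (simp add: mult_nonneg_nonpos)
    then have "(\<Sum>j\<in>J. k j * g j s) = 0"
      using lag[OF s(1)] sum_nonpos[of J "\<lambda>j. k j * g j s"] by simp
    then show ?thesis
      using sum_nonneg_eq_0_iff[of J "\<lambda>j. - (k j * g j s)"] fin nonpos
      by (simp add: sum_negf)
  qed
  then show ?thesis
    using c(2) k lag by (intro bexI[of _ "c * l None"] exI[of _ k]) auto
qed

section \<open>Replacing convex terms by subgradients\<close>

text \<open>Minimality of \<open>s\<close> says that the strict epigraph of \<open>h\<close> misses the set of points \<open>(A x, r)\<close> with
  \<open>r \<le> c - F x\<close>, where \<open>c\<close> is the minimal value. Both sets are convex, and a separating
  hyperplane is the graph of an affine function lying below \<open>h\<close> and above the second set. Both touch
  it over \<open>A s\<close>, so its slope is a subgradient there, and being above the second set is minimality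
  for the linearized problem.\<close>

lemma linearize_convex_term_unweighted:
  fixes h :: "'e::euclidean_space \<Rightarrow> real" and A :: "'s \<Rightarrow> 'e"
  assumes h: "convex_on UNIV h"
    and convexlike: "\<And>x y t. \<lbrakk>x \<in> S; y \<in> S; 0 \<le> t; t \<le> 1\<rbrakk> \<Longrightarrow>
      \<exists>z\<in>S. F z \<le> (1 - t) * F x + t * F y \<and> A z = (1 - t) *\<^sub>R A x + t *\<^sub>R A y"
    and s: "s \<in> S"
    and minimal: "\<And>x. x \<in> S \<Longrightarrow> F s + h (A s) \<le> F x + h (A x)"
  shows "\<exists>g\<in>subdifferential h (A s). \<forall>x\<in>S. F s + g \<bullet> A s \<le> F x + g \<bullet> A x"
proof -
  define c where "c = F s + h (A s)"
  define C where "C = {(z, r). h z < r}"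
  define D where "D = {(z, r). \<exists>x\<in>S. z = A x \<and> r \<le> c - F x}"
  have "convex C"
    unfolding convex_alt
  proof (intro ballI allI impI)
    fix p p' and t :: real
    assume p: "p \<in> C" "p' \<in> C" and t: "0 \<le> t \<and> t \<le> 1"
    have "h ((1 - t) *\<^sub>R fst p + t *\<^sub>R fst p') \<le> (1 - t) * h (fst p) + t * h (fst p')"
      using convex_onD[OF h, of t "fst p" "fst p'"] t by simp
    also have "\<dots> < (1 - t) * snd p + t * snd p'"
    proof (cases "t = 0")
      case True
      then show ?thesis using p by (auto simp: C_def)
    next
      case False
      then have "t * h (fst p') < t * snd p'" "(1 - t) * h (fst p) \<le> (1 - t) * snd p"
        using p t by (auto simp: C_def intro!: mult_left_mono)
      then show ?thesis by linarith
    qed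
    finally show "(1 - t) *\<^sub>R p + t *\<^sub>R p' \<in> C"
      by (cases p; cases p') (simp add: C_def)
  qed
  moreover have "convex D"
    unfolding convex_alt
  proof (intro ballI allI impI)
    fix p p' and t :: real
    assume p: "p \<in> D" "p' \<in> D" and t: "0 \<le> t \<and> t \<le> 1"
    obtain x where x: "x \<in> S" "fst p = A x" "snd p \<le> c - F x"
      using p(1) by (auto simp: D_def)
    obtain y where y: "y \<in> S" "fst p' = A y" "snd p' \<le> c - F y"
      using p(2) by (auto simp: D_def)
    obtain z where z: "z \<in> S" "F z \<le> (1 - t) * F x + t * F y" "A z = (1 - t) *\<^sub>R A x + t *\<^sub>R A y"
      using convexlike[OF x(1) y(1), of t] t by blast
    have "(1 - t) * snd p + t * snd p' \<le> (1 - t) * (c - F x) + t * (c - F y)"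
      using x y t by (intro add_mono mult_left_mono) auto
    also have "\<dots> \<le> c - F z"
      using z(2) by (simp add: algebra_simps)
    finally show "(1 - t) *\<^sub>R p + t *\<^sub>R p' \<in> D"
      unfolding D_def using z(1,3) x(2) y(2) by (cases p; cases p') (auto intro!: bexI[of _ z])
  qed
  moreover have "(0, h 0 + 1) \<in> C"
    by (simp add: C_def)
  moreover have "(A s, c - F s) \<in> D"
    using s by (auto simp: D_def)
  moreover have "C \<inter> D = {}"
    using minimal by (fastforce simp: C_def D_def c_def)
  ultimately obtain a b where a: "a \<noteq> 0" "\<forall>p\<in>C. a \<bullet> p \<le> b" "\<forall>p\<in>D. a \<bullet> p \<ge> b"
    using separating_hyperplane_sets[of C D] by blast
  obtain g \<tau> where g: "a = (g, \<tau>)"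
    by (cases a)
  have Cb: "g \<bullet> z + \<tau> * r \<le> b" if "h z < r" for z r
    using a(2) that by (auto simp: g C_def)
  have Db: "g \<bullet> A x + \<tau> * (c - F x) \<ge> b" if "x \<in> S" for x
    using a(3) that by (auto simp: g D_def)
  have "\<tau> \<le> 0"
  proof (rule ccontr)
    assume "\<not> \<tau> \<le> 0"
    define r where "r = max (h 0 + 1) ((b + 1) / \<tau>)"
    have "b + 1 \<le> \<tau> * r"
      using \<open>\<not> \<tau> \<le> 0\<close> by (simp add: r_def max_def field_simps)
    moreover have "h 0 < r"
      by (simp add: r_def less_max_iff_disj)
    ultimately show False
      using Cb[of 0 r] by simp
  qed
  \<comment> \<open>A vertical hyperplane cannot have the epigraph on one side, because the epigraph
    projects onto the whole space.\<close>
  moreover have "\<tau> \<noteq> 0"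
  proof
    assume "\<tau> = 0"
    then have "g \<noteq> 0" and bound: "g \<bullet> z \<le> b" for z
      using a(1) Cb[of z "h z + 1"] by (auto simp: g zero_prod_def)
    then have "g \<bullet> ((\<bar>b\<bar> + 1) / (g \<bullet> g)) *\<^sub>R g = \<bar>b\<bar> + 1"
      by simp
    then show False
      using bound[of "((\<bar>b\<bar> + 1) / (g \<bullet> g)) *\<^sub>R g"] by linarith
  qed
  ultimately have \<tau>: "\<tau> < 0"
    by simp
  define g' where "g' = (1 / (- \<tau>)) *\<^sub>R g"
  define b' where "b' = b / (- \<tau>)"
  have normalize: "(g \<bullet> z + \<tau> * r) / (- \<tau>) = g' \<bullet> z - r" for z r
    using \<tau> by (simp add: g'_def field_simps)
  have C': "g' \<bullet> z - h z \<le> b'" for z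
  proof (rule field_le_epsilon)
    fix e :: real assume "e > 0"
    then have "g \<bullet> z + \<tau> * (h z + e) \<le> b"
      by (intro Cb) simp
    from divide_right_mono[OF this, of "- \<tau>"] have "g' \<bullet> z - (h z + e) \<le> b'"
      unfolding normalize b'_def using \<tau> by simp
    then show "g' \<bullet> z - h z \<le> b' + e"
      by simp
  qed
  have D': "g' \<bullet> A x - (c - F x) \<ge> b'" if "x \<in> S" for x
    using divide_right_mono[OF Db[OF that], of "- \<tau>"] \<tau> unfolding normalize b'_def by simp
  have b': "b' = g' \<bullet> A s - h (A s)"
    using C'[of "A s"] D'[OF s] by (simp add: c_def)
  have "g' \<in> subdifferential h (A s)"
    using C' by (auto simp: subdifferential_def b' inner_diff_right algebra_simps)
  moreover have "F s + g' \<bullet> A s \<le> F x + g' \<bullet> A x" if "x \<in> S" for x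
    using D'[OF that] by (simp add: c_def b')
  ultimately show ?thesis
    by blast
qed

lemma linearize_convex_term:
  fixes h :: "'e::euclidean_space \<Rightarrow> real" and A :: "'s \<Rightarrow> 'e"
  assumes h: "convex_on UNIV h" and c: "0 \<le> c"
    and convexlike: "\<And>x y t. \<lbrakk>x \<in> S; y \<in> S; 0 \<le> t; t \<le> 1\<rbrakk> \<Longrightarrow>
      \<exists>z\<in>S. F z \<le> (1 - t) * F x + t * F y \<and> A z = (1 - t) *\<^sub>R A x + t *\<^sub>R A y"
    and s: "s \<in> S"
    and minimal: "\<And>x. x \<in> S \<Longrightarrow> F s + c * h (A s) \<le> F x + c * h (A x)"
  shows "\<exists>g\<in>subdifferential h (A s). \<forall>x\<in>S. F s + c * (g \<bullet> A s) \<le> F x + c * (g \<bullet> A x)"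
proof (cases "c = 0")
  case True
  \<comment> \<open>Only a subgradient is wanted; over the single point \<open>s\<close> everything is minimal.\<close>
  have "\<exists>g\<in>subdifferential h (A s). \<forall>x\<in>{s}. 0 + g \<bullet> A s \<le> 0 + g \<bullet> A x"
    by (rule linearize_convex_term_unweighted[OF h]) (auto simp flip: scaleR_left_distrib)
  then show ?thesis
    using minimal True by auto
next
  case False
  have "\<exists>g\<in>subdifferential h (A s). \<forall>x\<in>S. F s / c + g \<bullet> A s \<le> F x / c + g \<bullet> A x"
  proof (rule linearize_convex_term_unweighted[OF h _ s])
    fix x y and t :: real
    assume "x \<in> S" "y \<in> S" "0 \<le> t" "t \<le> 1"
    from convexlike[OF this] obtain z where z: "z \<in> S" "F z \<le> (1 - t) * F x + t * F y"
      "A z = (1 - t) *\<^sub>R A x + t *\<^sub>R A y"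
      by blast
    have "F z / c \<le> ((1 - t) * F x + t * F y) / c"
      using z(2) c by (intro divide_right_mono)
    then show "\<exists>z\<in>S. F z / c \<le> (1 - t) * (F x / c) + t * (F y / c) \<and>
        A z = (1 - t) *\<^sub>R A x + t *\<^sub>R A y"
      using z by (auto simp: add_divide_distrib)
  next
    fix x assume "x \<in> S"
    from divide_right_mono[OF minimal[OF this] c] show "F s / c + h (A s) \<le> F x / c + h (A x)"
      using False by (simp add: add_divide_distrib)
  qed
  then obtain g where g: "g \<in> subdifferential h (A s)"
    "\<forall>x\<in>S. F s / c + g \<bullet> A s \<le> F x / c + g \<bullet> A x"
    by blast
  have "F s + c * (g \<bullet> A s) \<le> F x + c * (g \<bullet> A x)" if "x \<in> S" for x
    using mult_left_mono[OF g(2)[rule_format, OF that] c] False by (simp add: distrib_left)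
  then show ?thesis
    using g(1) by blast
qed

text \<open>The linearized terms are affine under mixing, so they can join \<open>F\<close> while the next term is treated.\<close>

lemma linearize_convex_sum:
  fixes h :: "'j \<Rightarrow> 'e::euclidean_space \<Rightarrow> real" and A :: "'j \<Rightarrow> 's \<Rightarrow> 'e"
  assumes "finite J"
    and "\<And>j. j \<in> J \<Longrightarrow> convex_on UNIV (h j) \<and> 0 \<le> c j"
    and "\<And>x y t. \<lbrakk>x \<in> S; y \<in> S; 0 \<le> t; t \<le> 1\<rbrakk> \<Longrightarrow>
      \<exists>z\<in>S. F z \<le> (1 - t) * F x + t * F y \<and> (\<forall>j\<in>J. A j z = (1 - t) *\<^sub>R A j x + t *\<^sub>R A j y)"
    and "s \<in> S"
    and "\<And>x. x \<in> S \<Longrightarrow> F s + (\<Sum>j\<in>J. c j * h j (A j s)) \<le> F x + (\<Sum>j\<in>J. c j * h j (A j x))"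
  shows "\<exists>g. (\<forall>j\<in>J. g j \<in> subdifferential (h j) (A j s)) \<and>
    (\<forall>x\<in>S. F s + (\<Sum>j\<in>J. c j * (g j \<bullet> A j s)) \<le> F x + (\<Sum>j\<in>J. c j * (g j \<bullet> A j x)))"
  using assms
proof (induction J arbitrary: F rule: finite_induct)
  case empty
  then show ?case
    by simp
next
  case (insert a J)
  note [simp] = insert.hyps
  define G where "G x = F x + (\<Sum>j\<in>J. c j * h j (A j x))" for x
  have "\<exists>g\<in>subdifferential (h a) (A a s). \<forall>x\<in>S. G s + c a * (g \<bullet> A a s) \<le> G x + c a * (g \<bullet> A a x)"
  proof (rule linearize_convex_term)
    fix x y and t :: real
    assume t: "x \<in> S" "y \<in> S" "0 \<le> t" "t \<le> 1"
    from insert.prems(2)[OF this] obtain z where z: "z \<in> S" "F z \<le> (1 - t) * F x + t * F y"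
      "\<forall>j\<in>insert a J. A j z = (1 - t) *\<^sub>R A j x + t *\<^sub>R A j y"
      by blast
    have "(\<Sum>j\<in>J. c j * h j (A j z)) \<le>
        (\<Sum>j\<in>J. c j * ((1 - t) * h j (A j x) + t * h j (A j y)))"
    proof (intro sum_mono mult_left_mono)
      fix j assume "j \<in> J"
      then show "h j (A j z) \<le> (1 - t) * h j (A j x) + t * h j (A j y)"
        using z(3) convex_onD[of UNIV "h j" t "A j x" "A j y"] insert.prems(1) t by simp
    qed (use insert.prems(1) in simp)
    also have "\<dots> = (1 - t) * (\<Sum>j\<in>J. c j * h j (A j x)) + t * (\<Sum>j\<in>J. c j * h j (A j y))"
      by (rule sum_weighted_mix)
    finally have "G z \<le> (1 - t) * G x + t * G y"
      using z(2) by (simp add: G_def algebra_simps)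
    then show "\<exists>z\<in>S. G z \<le> (1 - t) * G x + t * G y \<and> A a z = (1 - t) *\<^sub>R A a x + t *\<^sub>R A a y"
      using z by blast
  next
    fix x assume "x \<in> S"
    from insert.prems(4)[OF this] show "G s + c a * h a (A a s) \<le> G x + c a * h a (A a x)"
      by (simp add: G_def algebra_simps)
  qed (use insert.prems in auto)
  then obtain ga where ga: "ga \<in> subdifferential (h a) (A a s)"
    "\<forall>x\<in>S. G s + c a * (ga \<bullet> A a s) \<le> G x + c a * (ga \<bullet> A a x)"
    by blast
  define F' where "F' x = F x + c a * (ga \<bullet> A a x)" for x
  have "\<exists>g. (\<forall>j\<in>J. g j \<in> subdifferential (h j) (A j s)) \<and>
    (\<forall>x\<in>S. F' s + (\<Sum>j\<in>J. c j * (g j \<bullet> A j s)) \<le> F' x + (\<Sum>j\<in>J. c j * (g j \<bullet> A j x)))"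
  proof (rule insert.IH)
    fix x y and t :: real
    assume "x \<in> S" "y \<in> S" "0 \<le> t" "t \<le> 1"
    from insert.prems(2)[OF this] obtain z where z: "z \<in> S" "F z \<le> (1 - t) * F x + t * F y"
      "\<forall>j\<in>insert a J. A j z = (1 - t) *\<^sub>R A j x + t *\<^sub>R A j y"
      by blast
    have "ga \<bullet> A a z = (1 - t) * (ga \<bullet> A a x) + t * (ga \<bullet> A a y)"
      using z(3) by (simp add: inner_add_right)
    then have "F' z = F z + ((1 - t) * (c a * (ga \<bullet> A a x)) + t * (c a * (ga \<bullet> A a y)))"
      by (simp only: F'_def distrib_left mult.left_commute)
    also have "\<dots> \<le> (1 - t) * F' x + t * F' y"
      using z(2) unfolding F'_def distrib_left by linarith
    finally have "F' z \<le> (1 - t) * F' x + t * F' y" .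
    then show "\<exists>z\<in>S. F' z \<le> (1 - t) * F' x + t * F' y \<and>
        (\<forall>j\<in>J. A j z = (1 - t) *\<^sub>R A j x + t *\<^sub>R A j y)"
      using z by blast
  next
    fix x assume "x \<in> S"
    with ga(2) show "F' s + (\<Sum>j\<in>J. c j * h j (A j s)) \<le> F' x + (\<Sum>j\<in>J. c j * h j (A j x))"
      by (auto simp: F'_def G_def algebra_simps)
  qed (use insert.prems in auto)
  then obtain g where g: "\<forall>j\<in>J. g j \<in> subdifferential (h j) (A j s)"
    "\<forall>x\<in>S. F' s + (\<Sum>j\<in>J. c j * (g j \<bullet> A j s)) \<le> F' x + (\<Sum>j\<in>J. c j * (g j \<bullet> A j x))"
    by blast
  have upd: "(\<Sum>j\<in>J. c j * ((g(a := ga)) j \<bullet> A j x)) = (\<Sum>j\<in>J. c j * (g j \<bullet> A j x))" for x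
    by (intro sum.cong) auto
  show ?case
    using g ga(1) upd by (intro exI[of _ "g(a := ga)"]) (auto simp: F'_def algebra_simps)
qed

section \<open>Gradients along segments\<close>

text \<open>A two-sided derivative at 0 is compared with a bound known only for small positive arguments, as
  it arises along a segment that starts at an interior point of a domain.\<close>

lemma derivative_le_right_slope:
  fixes \<psi> :: "real \<Rightarrow> real"
  assumes "(\<psi> has_real_derivative D) (at 0)"
    and "\<forall>\<^sub>F t in at_right 0. \<psi> t \<le> \<psi> 0 + t * M"
  shows "D \<le> M"
proof (rule tendsto_upperbound)
  show "((\<lambda>t. (\<psi> t - \<psi> 0) / t) \<longlongrightarrow> D) (at_right 0)"
    using has_field_derivative_at_within[OF assms(1), of "{0<..}"]
    by (simp add: has_field_derivative_iff)
  show "\<forall>\<^sub>F t in at_right 0. (\<psi> t - \<psi> 0) / t \<le> M"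
    using assms(2) eventually_at_right_less[of "0::real"]
    by eventually_elim (simp add: field_simps)
qed simp

lemma has_real_derivative_along_segment:
  fixes \<phi> :: "'a::real_inner \<Rightarrow> real"
  assumes "GDERIV \<phi> x :> g"
  shows "((\<lambda>t. \<phi> (x + t *\<^sub>R v)) has_real_derivative g \<bullet> v) (at 0)"
proof -
  have "((\<lambda>t. x + t *\<^sub>R v) has_derivative (\<lambda>t. t *\<^sub>R v)) (at 0)"
    by (auto intro!: derivative_eq_intros)
  moreover have "(\<phi> has_derivative (\<lambda>h. h \<bullet> g)) (at (x + 0 *\<^sub>R v))"
    using assms by (simp add: gderiv_def)
  ultimately have "((\<lambda>t. \<phi> (x + t *\<^sub>R v)) has_derivative (\<lambda>t. (t *\<^sub>R v) \<bullet> g)) (at 0)"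
    by (rule has_derivative_compose)
  then show ?thesis
    by (simp add: has_field_derivative_def inner_commute[of v] mult_commute_abs)
qed

lemma eventually_segment_in_interior:
  fixes x v :: "'a::real_normed_vector"
  assumes "x \<in> interior D"
  shows "\<forall>\<^sub>F t in at_right 0. x + t *\<^sub>R v \<in> D"
proof -
  have "((\<lambda>t. x + t *\<^sub>R v) \<longlongrightarrow> x + 0 *\<^sub>R v) (at_right 0)"
    by (intro tendsto_intros)
  then have "\<forall>\<^sub>F t in at_right 0. x + t *\<^sub>R v \<in> interior D"
    using assms by (intro topological_tendstoD) auto
  then show ?thesis
    by eventually_elim (use interior_subset in blast)
qed

lemma eventually_in_unit_interval_at_right:
  "\<forall>\<^sub>F t in at_right (0::real). 0 < t \<and> t < 1"
  using eventually_at_right_real[of 0 "1::real"] by simp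

lemma convex_fun_le_mix:
  fixes \<phi> :: "'a::real_vector \<Rightarrow> ereal"
  assumes "convex_fun \<phi>" "\<bar>\<phi> x\<bar> \<noteq> \<infinity>" "\<bar>\<phi> y\<bar> \<noteq> \<infinity>" "0 \<le> t" "t \<le> 1"
  shows "\<phi> ((1 - t) *\<^sub>R x + t *\<^sub>R y) \<le>
    ereal ((1 - t) * real_of_ereal (\<phi> x) + t * real_of_ereal (\<phi> y))"
proof -
  have "(x, real_of_ereal (\<phi> x)) \<in> {(x, r). \<phi> x \<le> ereal r}"
    "(y, real_of_ereal (\<phi> y)) \<in> {(x, r). \<phi> x \<le> ereal r}"
    using assms by (auto simp: ereal_real)
  then have "(1 - t) *\<^sub>R (x, real_of_ereal (\<phi> x)) + t *\<^sub>R (y, real_of_ereal (\<phi> y))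
      \<in> {(x, r). \<phi> x \<le> ereal r}"
    using assms(1,4,5) unfolding convex_fun_def by (intro convexD_alt)
  then show ?thesis
    by simp
qed

text \<open>Along the segment from \<open>x\<close> to \<open>y\<close> convexity bounds the difference quotients from above by the
  total increment. Only points near \<open>x\<close> are compared, since differentiability makes \<open>\<phi>\<close> finite
  there.\<close>

lemma convex_fun_gradient_inequality:
  fixes \<phi> :: "'a::real_inner \<Rightarrow> ereal"
  assumes "convex_fun \<phi>" "has_gradient \<phi> x g" "\<bar>\<phi> y\<bar> \<noteq> \<infinity>"
  shows "real_of_ereal (\<phi> x) + g \<bullet> (y - x) \<le> real_of_ereal (\<phi> y)"
proof -
  let ?r = "\<lambda>z. real_of_ereal (\<phi> z)"
  have x: "x \<in> interior {y. \<bar>\<phi> y\<bar> \<noteq> \<infinity>}" "GDERIV ?r x :> g"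
    using assms(2) by (auto simp: has_gradient_def)
  have finx: "\<bar>\<phi> x\<bar> \<noteq> \<infinity>"
    using subsetD[OF interior_subset x(1)] by simp
  have "g \<bullet> (y - x) \<le> ?r y - ?r x"
  proof (rule derivative_le_right_slope[OF has_real_derivative_along_segment[OF x(2)]])
    show "\<forall>\<^sub>F t in at_right 0. ?r (x + t *\<^sub>R (y - x)) \<le> ?r (x + 0 *\<^sub>R (y - x)) + t * (?r y - ?r x)"
      using eventually_segment_in_interior[OF x(1), of "y - x"] eventually_in_unit_interval_at_right
    proof eventually_elim
      case (elim t)
      have "\<phi> (x + t *\<^sub>R (y - x)) \<le> ereal ((1 - t) * ?r x + t * ?r y)"
        using convex_fun_le_mix[OF assms(1) finx assms(3), of t] elim by (simp add: algebra_simps)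
      moreover have "\<bar>\<phi> (x + t *\<^sub>R (y - x))\<bar> \<noteq> \<infinity>"
        using elim by simp
      ultimately have "?r (x + t *\<^sub>R (y - x)) \<le> (1 - t) * ?r x + t * ?r y"
        by (cases "\<phi> (x + t *\<^sub>R (y - x))") auto
      then show ?case
        by (simp add: algebra_simps)
    qed
  qed
  then show ?thesis
    by simp
qed

section \<open>Grid functions\<close>

definition grid_mix :: "real \<Rightarrow> (nat \<Rightarrow> 'a::real_vector) \<Rightarrow> (nat \<Rightarrow> 'a) \<Rightarrow> nat \<Rightarrow> 'a" where
  "grid_mix t x y = (\<lambda>i. (1 - t) *\<^sub>R x i + t *\<^sub>R y i)"

lemma grid_mix_segment: "grid_mix t x y i = x i + t *\<^sub>R (y i - x i)"
  by (simp add: grid_mix_def algebra_simps)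

lemma grid_mix_fixed: "x i = a \<Longrightarrow> y i = a \<Longrightarrow> grid_mix t x y i = a"
  by (simp add: grid_mix_segment)

lemma diff_point_grid_mix:
  "diff_point \<delta> (grid_mix t x y) i = (1 - t) *\<^sub>R diff_point \<delta> x i + t *\<^sub>R diff_point \<delta> y i"
proof -
  have mix: "(1 / \<delta>) *\<^sub>R ((1 - t) *\<^sub>R a + t *\<^sub>R b - ((1 - t) *\<^sub>R a' + t *\<^sub>R b')) =
      (1 - t) *\<^sub>R (1 / \<delta>) *\<^sub>R (a - a') + t *\<^sub>R (1 / \<delta>) *\<^sub>R (b - b')" for a b a' b' :: 'a
    by (simp add: scaleR_diff_right scaleR_add_right mult.commute)
  have "diff1 \<delta> (grid_mix t x y) i = (1 - t) *\<^sub>R diff1 \<delta> x i + t *\<^sub>R diff1 \<delta> y i" for i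
    by (simp only: diff1_def grid_mix_def mix)
  then show ?thesis
    by (simp only: diff_point_def diff2_def mix grid_mix_def scaleR_Pair add_Pair)
qed

lemma diff_point_diff:
  "diff_point \<delta> x i - diff_point \<delta> y i = diff_point \<delta> (\<lambda>i. x i - y i) i"
  by (simp add: diff_point_def diff2_def diff1_def algebra_simps)

lemma diff1_0_eq_iff:
  assumes "\<delta> \<noteq> 0"
  shows "diff1 \<delta> x 0 = v \<longleftrightarrow> x 1 = x 0 + \<delta> *\<^sub>R v"
proof -
  have "diff1 \<delta> x 0 = v \<longleftrightarrow> \<delta> *\<^sub>R diff1 \<delta> x 0 = \<delta> *\<^sub>R v"
    using assms by simp
  also have "\<delta> *\<^sub>R diff1 \<delta> x 0 = x 1 - x 0"
    using assms by (simp add: diff1_def)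
  also have "x 1 - x 0 = \<delta> *\<^sub>R v \<longleftrightarrow> x 1 = x 0 + \<delta> *\<^sub>R v"
    by (auto simp: algebra_simps)
  finally show ?thesis .
qed

text \<open>The summand is a difference of shifted copies of \<open>u \<bullet> w\<close> and of \<open>x \<bullet> w\<close>, shifted by one and
  by two steps respectively, so the sum telescopes. The values at the left end disappear
  because \<open>w\<close> vanishes there.\<close>

lemma summation_by_parts_second_order:
  fixes x u w :: "nat \<Rightarrow> 'a::real_inner"
  assumes w: "w 0 = 0" "w 1 = 0"
  shows "(\<Sum>i=0..M. (x i - u i) \<bullet> w i + u (i + 1) \<bullet> w (i + 1) - x (i + 2) \<bullet> w (i + 2)) =
    (u (M + 1) - x (M + 1)) \<bullet> w (M + 1) - x (M + 2) \<bullet> w (M + 2)"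
proof (induction M)
  case 0
  show ?case
    using w by (simp add: inner_diff_left)
next
  case (Suc M)
  then show ?case
    by (simp add: inner_diff_left)
qed

text \<open>The scaling of the three components is the one for which all difference quotients combine into
  the common factor \<open>1 / \<delta>\<^sup>2\<close>: in terms of \<open>w i\<close>, \<open>w (i + 1)\<close> and \<open>w (i + 2)\<close> the coefficients
  become \<open>x i - u i - c i\<close>, \<open>u (i + 1)\<close> and \<open>- x (i + 2)\<close>.\<close>

lemma adjoint_identity:
  fixes x u c w :: "nat \<Rightarrow> 'a::real_inner"
  assumes "\<delta> \<noteq> 0" "N \<ge> 2" and w: "w 0 = 0" "w 1 = 0"
  shows "(\<Sum>i=0..N-2. ((1 / \<delta>\<^sup>2) *\<^sub>R (x i - u i + u (i + 1) - x (i + 2) - c i),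
        (1 / \<delta>) *\<^sub>R (u (i + 1) - 2 *\<^sub>R x (i + 2)), - x (i + 2)) \<bullet> diff_point \<delta> w i) =
    (1 / \<delta>\<^sup>2) * ((u (N - 1) - x (N - 1)) \<bullet> w (N - 1) - x N \<bullet> w N - (\<Sum>i=2..N-2. c i \<bullet> w i))"
proof -
  define T where "T i = (x i - u i) \<bullet> w i + u (i + 1) \<bullet> w (i + 1) - x (i + 2) \<bullet> w (i + 2)" for i
  have "((1 / \<delta>\<^sup>2) *\<^sub>R (x i - u i + u (i + 1) - x (i + 2) - c i),
        (1 / \<delta>) *\<^sub>R (u (i + 1) - 2 *\<^sub>R x (i + 2)), - x (i + 2)) \<bullet> diff_point \<delta> w i =
      (1 / \<delta>\<^sup>2) * (T i - c i \<bullet> w i)"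
    for i
  proof -
    have "diff_point \<delta> w i = (w i, (1 / \<delta>) *\<^sub>R (w (i + 1) - w i),
        (1 / \<delta>\<^sup>2) *\<^sub>R ((w (i + 2) - w (i + 1)) - (w (i + 1) - w i)))"
      by (simp add: diff_point_def diff2_def diff1_def power2_eq_square flip: scaleR_diff_right)
    then have "((1 / \<delta>\<^sup>2) *\<^sub>R (x i - u i + u (i + 1) - x (i + 2) - c i),
        (1 / \<delta>) *\<^sub>R (u (i + 1) - 2 *\<^sub>R x (i + 2)), - x (i + 2)) \<bullet> diff_point \<delta> w i =
        (1 / \<delta>\<^sup>2) * ((x i - u i + u (i + 1) - x (i + 2) - c i) \<bullet> w i +
          (u (i + 1) - 2 *\<^sub>R x (i + 2)) \<bullet> (w (i + 1) - w i) +
          (- x (i + 2)) \<bullet> ((w (i + 2) - w (i + 1)) - (w (i + 1) - w i)))"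
      by (simp only: inner_Pair inner_scaleR_left inner_scaleR_right distrib_left power2_eq_square
          mult.assoc[symmetric] times_divide_times_eq mult_1_left mult_1_right inner_real_def
          inner_minus_left)
    also have "(x i - u i + u (i + 1) - x (i + 2) - c i) \<bullet> w i +
          (u (i + 1) - 2 *\<^sub>R x (i + 2)) \<bullet> (w (i + 1) - w i) +
          (- x (i + 2)) \<bullet> ((w (i + 2) - w (i + 1)) - (w (i + 1) - w i)) = T i - c i \<bullet> w i"
      by (simp add: T_def inner_diff_left inner_diff_right inner_add_left)
    finally show ?thesis .
  qed
  then have "(\<Sum>i=0..N-2. ((1 / \<delta>\<^sup>2) *\<^sub>R (x i - u i + u (i + 1) - x (i + 2) - c i),
        (1 / \<delta>) *\<^sub>R (u (i + 1) - 2 *\<^sub>R x (i + 2)), - x (i + 2)) \<bullet> diff_point \<delta> w i) =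
      (1 / \<delta>\<^sup>2) * ((\<Sum>i=0..N-2. T i) - (\<Sum>i=0..N-2. c i \<bullet> w i))"
    by (simp only: sum_subtractf flip: sum_distrib_left)
  moreover have "(\<Sum>i=2..N-2. c i \<bullet> w i) = (\<Sum>i=0..N-2. c i \<bullet> w i)"
  proof (rule sum.mono_neutral_left)
    show "\<forall>i\<in>{0..N-2} - {2..N-2}. c i \<bullet> w i = 0"
    proof
      fix i assume "i \<in> {0..N-2} - {2..N-2}"
      then have "i = 0 \<or> i = 1" by auto
      then show "c i \<bullet> w i = 0" using w by auto
    qed
  qed auto
  moreover have "(\<Sum>i=0..N-2. T i) = (u (N - 1) - x (N - 1)) \<bullet> w (N - 1) - x N \<bullet> w N"
  proof -
    have "N - 2 + 1 = N - 1" "N - 2 + 2 = N"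
      using assms(2) by auto
    then show ?thesis
      unfolding T_def using summation_by_parts_second_order[of w x u "N - 2", OF w] by simp
  qed
  ultimately show ?thesis
    by simp
qed

lemma pda_cost_finite:
  assumes "\<And>i. i \<in> {2..N-2} \<Longrightarrow> \<bar>f (x i) i\<bar> \<noteq> \<infinity>"
  shows "pda_cost N \<delta> f q x =
    ereal (\<delta> * (\<Sum>i=2..N-2. real_of_ereal (f (x i) i)) + q (x (N - 1)))"
proof -
  have "(\<Sum>i=2..N-2. ereal \<delta> * f (x i) i) = (\<Sum>i=2..N-2. ereal (\<delta> * real_of_ereal (f (x i) i)))"
  proof (rule sum.cong)
    fix i assume "i \<in> {2..N-2}"
    then show "ereal \<delta> * f (x i) i = ereal (\<delta> * real_of_ereal (f (x i) i))"
      using assms[of i] by (cases "f (x i) i") auto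
  qed simp
  then show ?thesis
    by (simp add: pda_cost_def sum_distrib_left)
qed

lemma pda_cost_infinite:
  assumes "\<delta> > 0" "i \<in> {2..N-2}" "f (x i) i = \<infinity>"
  shows "pda_cost N \<delta> f q x = \<infinity>"
proof -
  have "(\<Sum>i=2..N-2. ereal \<delta> * f (x i) i) = \<infinity>"
    unfolding sum_Pinfty using assms by (auto intro!: bexI[of _ i])
  then show ?thesis
    by (simp add: pda_cost_def)
qed

section \<open>Necessity\<close>

text \<open>The domains \<open>D i\<close> need not contain the values of \<open>x\<close>: only the initial part of the segment from
  \<open>s\<close> to \<open>x\<close> is used, on which minimality bounds the decrease of the smooth terms by the increase of
  \<open>H\<close>, which is at most linear in the parameter. Thus infinite values of the cost far from
  \<open>s\<close> do no harm.\<close>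

lemma linearize_smooth_terms:
  fixes \<phi> :: "nat \<Rightarrow> 'a::real_inner \<Rightarrow> real" and H :: "(nat \<Rightarrow> 'a) \<Rightarrow> real"
  assumes "finite I"
    and smooth: "\<And>i. i \<in> I \<Longrightarrow> GDERIV (\<phi> i) (s i) :> g i \<and> s i \<in> interior (D i)"
    and H: "\<And>t. 0 \<le> t \<Longrightarrow> t \<le> 1 \<Longrightarrow> H (grid_mix t s x) \<le> (1 - t) * H s + t * H x"
    and minimal: "\<And>t. \<lbrakk>0 \<le> t; t \<le> 1; \<And>i. i \<in> I \<Longrightarrow> grid_mix t s x i \<in> D i\<rbrakk> \<Longrightarrow>
      c * (\<Sum>i\<in>I. \<phi> i (s i)) + H s \<le> c * (\<Sum>i\<in>I. \<phi> i (grid_mix t s x i)) + H (grid_mix t s x)"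
  shows "H s \<le> c * (\<Sum>i\<in>I. g i \<bullet> (x i - s i)) + H x"
proof -
  define \<psi> where "\<psi> t = - (c * (\<Sum>i\<in>I. \<phi> i (s i + t *\<^sub>R (x i - s i))))" for t
  have "(\<psi> has_real_derivative - (c * (\<Sum>i\<in>I. g i \<bullet> (x i - s i)))) (at 0)"
    unfolding \<psi>_def
    by (intro DERIV_minus DERIV_cmult DERIV_sum has_real_derivative_along_segment)
      (use smooth in auto)
  moreover have "\<forall>\<^sub>F t in at_right 0. \<psi> t \<le> \<psi> 0 + t * (H x - H s)"
  proof -
    have "\<forall>\<^sub>F t in at_right 0. \<forall>i\<in>I. s i + t *\<^sub>R (x i - s i) \<in> D i"
      using assms(1) smooth by (intro eventually_ball_finite ballI eventually_segment_in_interior) auto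
    then show ?thesis
      using eventually_in_unit_interval_at_right
    proof eventually_elim
      case (elim t)
      then have "- \<psi> 0 + H s \<le> - \<psi> t + H (grid_mix t s x)"
        using minimal[of t] by (simp add: \<psi>_def grid_mix_segment)
      also have "\<dots> \<le> - \<psi> t + ((1 - t) * H s + t * H x)"
        using H[of t] elim by simp
      finally show ?case
        by (simp add: algebra_simps)
    qed
  qed
  ultimately have "- (c * (\<Sum>i\<in>I. g i \<bullet> (x i - s i))) \<le> H x - H s"
    by (rule derivative_le_right_slope)
  then show ?thesis
    by simp
qed

text \<open>The cost is divided by \<open>\<delta>\<^sup>2\<close> so that the multiplier normalized to 0 or 1 is the one that appears
  in the adjoint inclusion, whose first component carries the factor \<open>1 / \<delta>\<^sup>2\<close>.\<close>

lemma pda_fritz_john: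
  fixes W :: "nat \<Rightarrow> 'a::euclidean_space \<times> 'a \<times> 'a \<Rightarrow> real" and f :: "'a \<Rightarrow> nat \<Rightarrow> ereal"
  assumes \<delta>: "\<delta> > 0"
    and W: "\<And>k. k \<in> {1..m} \<Longrightarrow> convex_on UNIV (W k)"
    and q: "convex_on UNIV q"
    and f: "\<And>i. i \<in> {2..N-2} \<Longrightarrow> proper_fun (\<lambda>x. f x i) \<and> convex_fun (\<lambda>x. f x i)"
    and finite_cost: "\<And>i. i \<in> {2..N-2} \<Longrightarrow> \<bar>f (s i) i\<bar> \<noteq> \<infinity>"
    and optimal: "pda_optimal N \<delta> m W f q \<upsilon>0 \<upsilon>1 s"
  defines "J \<equiv> \<lambda>x. \<delta> * (\<Sum>i=2..N-2. real_of_ereal (f (x i) i)) + q (x (N - 1))"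
  shows "\<exists>\<mu>\<in>{0, 1}. \<exists>\<alpha>.
    (\<forall>i\<in>{0..N-2}. \<forall>k\<in>{1..m}. 0 \<le> \<alpha> i k \<and> \<alpha> i k * W k (diff_point \<delta> s i) = 0) \<and>
    (\<mu> \<noteq> 0 \<or> (\<exists>i\<in>{0..N-2}. \<exists>k\<in>{1..m}. \<alpha> i k \<noteq> 0)) \<and>
    (\<forall>x. x 0 = s 0 \<and> x 1 = s 1 \<and> (\<forall>i\<in>{2..N-2}. \<bar>f (x i) i\<bar> \<noteq> \<infinity>) \<longrightarrow>
      0 \<le> \<mu> * (J x / \<delta>\<^sup>2 - J s / \<delta>\<^sup>2) +
        (\<Sum>(i, k)\<in>{0..N-2} \<times> {1..m}. \<alpha> i k * W k (diff_point \<delta> x i)))"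
proof -
  define S where "S = {x. x 0 = s 0 \<and> x 1 = s 1 \<and> (\<forall>i\<in>{2..N-2}. \<bar>f (x i) i\<bar> \<noteq> \<infinity>)}"
  define g where "g = (\<lambda>(i, k) x. W k (diff_point \<delta> x i))"
  let ?K = "{0..N-2} \<times> {1..m}"
  have feas: "pda_feasible N \<delta> m W \<upsilon>0 \<upsilon>1 s"
    using optimal by (simp add: pda_optimal_def)
  have "\<exists>\<mu>\<in>{0, 1}. \<exists>l. (\<forall>j\<in>?K. 0 \<le> l j \<and> l j * g j s = 0) \<and> (\<mu> \<noteq> 0 \<or> (\<exists>j\<in>?K. l j \<noteq> 0)) \<and>
    (\<forall>x\<in>S. 0 \<le> \<mu> * (J x / \<delta>\<^sup>2 - J s / \<delta>\<^sup>2) + (\<Sum>j\<in>?K. l j * g j x))"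
  proof (rule fritz_john_convexlike)
    fix x y and t :: real
    assume xy: "x \<in> S" "y \<in> S" and t: "0 \<le> t" "t \<le> 1"
    have fmix: "\<bar>f (grid_mix t x y i) i\<bar> \<noteq> \<infinity> \<and> real_of_ereal (f (grid_mix t x y i) i) \<le>
        (1 - t) * real_of_ereal (f (x i) i) + t * real_of_ereal (f (y i) i)" if i: "i \<in> {2..N-2}" for i
    proof -
      have "f (grid_mix t x y i) i \<noteq> -\<infinity>"
        using f[OF i] by (simp add: proper_fun_def)
      moreover have "f (grid_mix t x y i) i \<le>
          ereal ((1 - t) * real_of_ereal (f (x i) i) + t * real_of_ereal (f (y i) i))"
        unfolding grid_mix_def
        by (rule convex_fun_le_mix) (use f[OF i] xy t i in \<open>auto simp: S_def\<close>)
      ultimately show ?thesis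
        by (cases "f (grid_mix t x y i) i") auto
    qed
    have "grid_mix t x y \<in> S"
      using xy fmix by (auto simp: S_def intro!: grid_mix_fixed)
    moreover have "J (grid_mix t x y) \<le> (1 - t) * J x + t * J y"
    proof -
      have "(\<Sum>i=2..N-2. real_of_ereal (f (grid_mix t x y i) i)) \<le>
          (\<Sum>i=2..N-2. (1 - t) * real_of_ereal (f (x i) i) + t * real_of_ereal (f (y i) i))"
        using fmix by (intro sum_mono) auto
      then have "(\<Sum>i=2..N-2. real_of_ereal (f (grid_mix t x y i) i)) \<le>
          (1 - t) * (\<Sum>i=2..N-2. real_of_ereal (f (x i) i)) +
          t * (\<Sum>i=2..N-2. real_of_ereal (f (y i) i))"
        by (simp only: sum.distrib sum_distrib_left)
      from mult_left_mono[OF this less_imp_le[OF \<delta>]] have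
        "\<delta> * (\<Sum>i=2..N-2. real_of_ereal (f (grid_mix t x y i) i)) \<le>
          (1 - t) * (\<delta> * (\<Sum>i=2..N-2. real_of_ereal (f (x i) i))) +
          t * (\<delta> * (\<Sum>i=2..N-2. real_of_ereal (f (y i) i)))"
        by (simp only: distrib_left mult.left_commute)
      moreover have "q (grid_mix t x y (N - 1)) \<le> (1 - t) * q (x (N - 1)) + t * q (y (N - 1))"
        unfolding grid_mix_def using convex_onD[OF q t] by simp
      ultimately show ?thesis
        unfolding J_def distrib_left by linarith
    qed
    then have "J (grid_mix t x y) / \<delta>\<^sup>2 \<le> (1 - t) * (J x / \<delta>\<^sup>2) + t * (J y / \<delta>\<^sup>2)"
      using divide_right_mono[of _ _ "\<delta>\<^sup>2"] by (fastforce simp: add_divide_distrib)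
    moreover have "\<forall>j\<in>?K. g j (grid_mix t x y) \<le> (1 - t) * g j x + t * g j y"
      using convex_onD[OF W t] by (auto simp: g_def diff_point_grid_mix)
    ultimately show "\<exists>z\<in>S. J z / \<delta>\<^sup>2 \<le> (1 - t) * (J x / \<delta>\<^sup>2) + t * (J y / \<delta>\<^sup>2) \<and>
        (\<forall>j\<in>?K. g j z \<le> (1 - t) * g j x + t * g j y)"
      by blast
  next
    show "s \<in> S"
      using finite_cost by (simp add: S_def)
    show "g j s \<le> 0" if "j \<in> ?K" for j
      using feas that by (auto simp: g_def pda_feasible_def)
  next
    fix x assume x: "x \<in> S" "\<And>j. j \<in> ?K \<Longrightarrow> g j x \<le> 0"
    have "pda_feasible N \<delta> m W \<upsilon>0 \<upsilon>1 x"
      using feas x \<delta> unfolding pda_feasible_def S_def g_def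
      by (auto simp: diff1_0_eq_iff)
    then have "pda_cost N \<delta> f q s \<le> pda_cost N \<delta> f q x"
      using optimal by (simp add: pda_optimal_def)
    then have "J s \<le> J x"
      using pda_cost_finite[where x = s and N = N and f = f] pda_cost_finite[where x = x and N = N and f = f]
        finite_cost x(1) by (simp add: J_def S_def)
    then show "J s / \<delta>\<^sup>2 \<le> J x / \<delta>\<^sup>2"
      by (simp add: divide_right_mono)
  qed simp
  then obtain \<mu> l where l: "\<mu> \<in> {0, 1}" "\<forall>j\<in>?K. 0 \<le> l j \<and> l j * g j s = 0"
    "\<mu> \<noteq> 0 \<or> (\<exists>j\<in>?K. l j \<noteq> 0)"
    "\<forall>x\<in>S. 0 \<le> \<mu> * (J x / \<delta>\<^sup>2 - J s / \<delta>\<^sup>2) + (\<Sum>j\<in>?K. l j * g j x)"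
    by blast
  have sum_eq: "(\<Sum>j\<in>?K. l j * g j x) = (\<Sum>(i, k)\<in>?K. l (i, k) * W k (diff_point \<delta> x i))" for x
    by (intro sum.cong) (auto simp: g_def)
  note lagrangian = l(4)[unfolded sum_eq]
  show ?thesis
    using l(1)
  proof (rule bexI[rotated], intro exI[of _ "\<lambda>i k. l (i, k)"] conjI)
    show "\<forall>i\<in>{0..N-2}. \<forall>k\<in>{1..m}. 0 \<le> l (i, k) \<and> l (i, k) * W k (diff_point \<delta> s i) = 0"
      using l(2) by (auto simp: g_def)
    show "\<mu> \<noteq> 0 \<or> (\<exists>i\<in>{0..N-2}. \<exists>k\<in>{1..m}. l (i, k) \<noteq> 0)"
      using l(3) by blast
  qed (use lagrangian in \<open>auto simp: S_def\<close>)
qed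

text \<open>The Lagrangian is linearized at \<open>s\<close> in three rounds: the \<open>f\<close>-terms (\<open>L\<close>), the terminal term, and
  the constraint terms (\<open>Q\<close>). The conclusion is stated for variations \<open>w = x - s\<close>, for which the
  linear functional is minimal at 0.\<close>

lemma pda_stationarity:
  fixes W :: "nat \<Rightarrow> 'a::euclidean_space \<times> 'a \<times> 'a \<Rightarrow> real" and f :: "'a \<Rightarrow> nat \<Rightarrow> ereal"
  assumes \<delta>: "\<delta> > 0"
    and W: "\<And>k. k \<in> {1..m} \<Longrightarrow> convex_on UNIV (W k)"
    and q: "convex_on UNIV q"
    and f': "\<And>i. i \<in> {2..N-2} \<Longrightarrow> has_gradient (\<lambda>y. f y i) (s i) (f' i)"
    and \<mu>: "0 \<le> \<mu>" and \<alpha>: "\<And>i k. i \<in> {0..N-2} \<Longrightarrow> k \<in> {1..m} \<Longrightarrow> 0 \<le> \<alpha> i k \<and> \<alpha> i k * W k (diff_point \<delta> s i) = 0"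
    and minimal: "\<And>x. \<lbrakk>x 0 = s 0; x 1 = s 1; \<And>i. i \<in> {2..N-2} \<Longrightarrow> \<bar>f (x i) i\<bar> \<noteq> \<infinity>\<rbrakk> \<Longrightarrow>
      0 \<le> \<mu> * ((\<delta> * (\<Sum>i=2..N-2. real_of_ereal (f (x i) i)) + q (x (N - 1))) / \<delta>\<^sup>2 -
            (\<delta> * (\<Sum>i=2..N-2. real_of_ereal (f (s i) i)) + q (s (N - 1))) / \<delta>\<^sup>2) +
        (\<Sum>(i, k)\<in>{0..N-2} \<times> {1..m}. \<alpha> i k * W k (diff_point \<delta> x i))"
  shows "\<exists>g. \<exists>gq\<in>subdifferential q (s (N - 1)).
    (\<forall>i\<in>{0..N-2}. \<forall>k\<in>{1..m}. g i k \<in> subdifferential (W k) (diff_point \<delta> s i)) \<and>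
    (\<forall>w. w 0 = 0 \<and> w 1 = 0 \<longrightarrow>
      0 \<le> \<mu> / \<delta> * (\<Sum>i=2..N-2. f' i \<bullet> w i) + \<mu> / \<delta>\<^sup>2 * (gq \<bullet> w (N - 1)) +
        (\<Sum>i=0..N-2. (\<Sum>k=1..m. \<alpha> i k *\<^sub>R g i k) \<bullet> diff_point \<delta> w i))"
proof -
  define S where "S = {x :: nat \<Rightarrow> 'a. x 0 = s 0 \<and> x 1 = s 1}"
  let ?K = "{0..N-2} \<times> {1..m}"
  define c where "c j = \<alpha> (fst j) (snd j)" for j
  define A where "A j x = diff_point \<delta> x (fst j)" for j :: "nat \<times> nat" and x :: "nat \<Rightarrow> 'a"
  define Q where "Q x = (\<Sum>j\<in>?K. c j * W (snd j) (A j x))" for x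
  define L where "L x = \<mu> / \<delta> * (\<Sum>i=2..N-2. f' i \<bullet> x i)" for x
  have Q_eq: "(\<Sum>(i, k)\<in>?K. \<alpha> i k * W k (diff_point \<delta> x i)) = Q x" for x
    by (simp add: Q_def c_def A_def case_prod_unfold)
  have Q_s: "Q s = 0"
    unfolding Q_def using \<alpha> by (intro sum.neutral) (auto simp: c_def A_def)
  have S: "s \<in> S" "\<And>x y t. x \<in> S \<Longrightarrow> y \<in> S \<Longrightarrow> grid_mix t x y \<in> S"
    by (auto simp: S_def intro: grid_mix_fixed)
  have A_mix: "A j (grid_mix t x y) = (1 - t) *\<^sub>R A j x + t *\<^sub>R A j y" for j t x y
    by (simp add: A_def diff_point_grid_mix)
  have L_mix: "L (grid_mix t x y) = (1 - t) * L x + t * L y" for t x y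
  proof -
    have "(\<Sum>i=2..N-2. f' i \<bullet> grid_mix t x y i) =
        (1 - t) * (\<Sum>i=2..N-2. f' i \<bullet> x i) + t * (\<Sum>i=2..N-2. f' i \<bullet> y i)"
      by (simp only: grid_mix_def inner_add_right inner_scaleR_right sum.distrib sum_distrib_left)
    then show ?thesis
      by (simp only: L_def distrib_left mult.left_commute)
  qed
  have Q_mix: "Q (grid_mix t x y) \<le> (1 - t) * Q x + t * Q y" if "0 \<le> t" "t \<le> 1" for t x y
  proof -
    have "Q (grid_mix t x y) \<le>
        (\<Sum>j\<in>?K. c j * ((1 - t) * W (snd j) (A j x) + t * W (snd j) (A j y)))"
      unfolding Q_def A_mix
    proof (intro sum_mono mult_left_mono)
      fix j assume "j \<in> ?K"
      then have "snd j \<in> {1..m}" "fst j \<in> {0..N-2}"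
        by auto
      then show "W (snd j) ((1 - t) *\<^sub>R A j x + t *\<^sub>R A j y) \<le>
          (1 - t) * W (snd j) (A j x) + t * W (snd j) (A j y)" "0 \<le> c j"
        using convex_onD[OF W that, of "snd j" "A j x" "A j y"] \<alpha> by (auto simp: c_def)
    qed
    also have "\<dots> = (1 - t) * Q x + t * Q y"
      unfolding Q_def by (rule sum_weighted_mix)
    finally show ?thesis .
  qed
  have q_mix: "q (grid_mix t x y i) \<le> (1 - t) * q (x i) + t * q (y i)" if "0 \<le> t" "t \<le> 1" for t x y i
    unfolding grid_mix_def using convex_onD[OF q that] by simp
  define r where "r = \<mu> / \<delta>\<^sup>2"
  have r: "r \<ge> 0"
    using \<mu> by (simp add: r_def)
  have smooth: "L s + Q s + r * q (s (N - 1)) \<le> L x + Q x + r * q (x (N - 1))" if x: "x \<in> S" for x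
  proof -
    define H where "H x = Q x + r * q (x (N - 1))" for x
    have "H s \<le> \<mu> / \<delta> * (\<Sum>i\<in>{2..N-2}. f' i \<bullet> (x i - s i)) + H x"
    proof (rule linearize_smooth_terms)
      fix i assume "i \<in> {2..N-2}"
      from f'[OF this] show "GDERIV (\<lambda>y. real_of_ereal (f y i)) (s i) :> f' i \<and>
          s i \<in> interior {y. \<bar>f y i\<bar> \<noteq> \<infinity>}"
        by (simp add: has_gradient_def)
    next
      fix t :: real assume t: "0 \<le> t" "t \<le> 1"
      have "r * q (grid_mix t s x (N - 1)) \<le> (1 - t) * (r * q (s (N - 1))) + t * (r * q (x (N - 1)))"
        using mult_left_mono[OF q_mix[OF t] r] by (simp only: distrib_left mult.left_commute)
      then show "H (grid_mix t s x) \<le> (1 - t) * H s + t * H x"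
        using Q_mix[OF t] unfolding H_def distrib_left by (smt (verit))
    next
      fix t :: real
      assume "0 \<le> t" "t \<le> 1" and fin: "\<And>i. i \<in> {2..N-2} \<Longrightarrow> grid_mix t s x i \<in> {y. \<bar>f y i\<bar> \<noteq> \<infinity>}"
      let ?z = "grid_mix t s x"
      have "\<mu> * ((\<delta> * F + a) / \<delta>\<^sup>2 - (\<delta> * F' + a') / \<delta>\<^sup>2) = (\<mu> / \<delta> * F + r * a) - (\<mu> / \<delta> * F' + r * a')"
        for F F' a a'
        using \<delta> by (simp add: r_def field_simps power2_eq_square)
      then show "\<mu> / \<delta> * (\<Sum>i\<in>{2..N-2}. real_of_ereal (f (s i) i)) + H s \<le>
          \<mu> / \<delta> * (\<Sum>i\<in>{2..N-2}. real_of_ereal (f (?z i) i)) + H ?z"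
        using minimal[of ?z, unfolded Q_eq] fin S(2)[OF S(1) x, of t] Q_s
        by (simp add: H_def S_def)
    qed simp
    then show ?thesis
      by (simp add: L_def H_def inner_diff_right sum_subtractf right_diff_distrib)
  qed
  have "\<exists>gq\<in>subdifferential q (s (N - 1)). \<forall>x\<in>S. L s + Q s + r * (gq \<bullet> s (N - 1)) \<le>
      L x + Q x + r * (gq \<bullet> x (N - 1))"
  proof (rule linearize_convex_term[where F = "\<lambda>x. L x + Q x" and A = "\<lambda>x. x (N - 1)",
        OF q r _ S(1) smooth])
    fix x y and t :: real
    assume "x \<in> S" "y \<in> S" "0 \<le> t" "t \<le> 1"
    then show "\<exists>z\<in>S. L z + Q z \<le> (1 - t) * (L x + Q x) + t * (L y + Q y) \<and>
        z (N - 1) = (1 - t) *\<^sub>R x (N - 1) + t *\<^sub>R y (N - 1)"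
      using S(2)[of x y t] L_mix[of t x y] Q_mix[of t x y]
      by (intro bexI[of _ "grid_mix t x y"]) (auto simp: grid_mix_def distrib_left)
  qed
  then obtain gq where gq: "gq \<in> subdifferential q (s (N - 1))"
    "\<forall>x\<in>S. L s + Q s + r * (gq \<bullet> s (N - 1)) \<le> L x + Q x + r * (gq \<bullet> x (N - 1))"
    by blast
  define R where "R x = L x + r * (gq \<bullet> x (N - 1))" for x
  have "\<exists>g. (\<forall>j\<in>?K. g j \<in> subdifferential (W (snd j)) (A j s)) \<and>
    (\<forall>x\<in>S. R s + (\<Sum>j\<in>?K. c j * (g j \<bullet> A j s)) \<le> R x + (\<Sum>j\<in>?K. c j * (g j \<bullet> A j x)))"
  proof (rule linearize_convex_sum[where F = R and A = A and h = "\<lambda>j. W (snd j)",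
        OF _ _ _ S(1)])
    fix x y and t :: real
    assume xy: "x \<in> S" "y \<in> S"
    have "r * (gq \<bullet> grid_mix t x y (N - 1)) =
        (1 - t) * (r * (gq \<bullet> x (N - 1))) + t * (r * (gq \<bullet> y (N - 1)))"
      by (simp only: grid_mix_def inner_add_right inner_scaleR_right distrib_left mult.left_commute)
    then have "R (grid_mix t x y) = (1 - t) * R x + t * R y"
      unfolding R_def L_mix distrib_left by linarith
    then show "\<exists>z\<in>S. R z \<le> (1 - t) * R x + t * R y \<and> (\<forall>j\<in>?K. A j z = (1 - t) *\<^sub>R A j x + t *\<^sub>R A j y)"
      using S(2)[OF xy, of t] A_mix by (intro bexI[of _ "grid_mix t x y"]) auto
  next
    fix x assume "x \<in> S"
    then show "R s + (\<Sum>j\<in>?K. c j * W (snd j) (A j s)) \<le> R x + (\<Sum>j\<in>?K. c j * W (snd j) (A j x))"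
      using gq(2) by (auto simp: R_def Q_def algebra_simps)
  qed (use W \<alpha> in \<open>auto simp: c_def\<close>)
  then obtain g where g: "\<forall>j\<in>?K. g j \<in> subdifferential (W (snd j)) (A j s)"
    "\<forall>x\<in>S. R s + (\<Sum>j\<in>?K. c j * (g j \<bullet> A j s)) \<le> R x + (\<Sum>j\<in>?K. c j * (g j \<bullet> A j x))"
    by blast
  have "0 \<le> \<mu> / \<delta> * (\<Sum>i=2..N-2. f' i \<bullet> w i) + \<mu> / \<delta>\<^sup>2 * (gq \<bullet> w (N - 1)) +
        (\<Sum>i=0..N-2. (\<Sum>k=1..m. \<alpha> i k *\<^sub>R g (i, k)) \<bullet> diff_point \<delta> w i)"
    if w: "w 0 = 0" "w 1 = 0" for w
  proof -
    define x where "x i = s i + w i" for i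
    have "x \<in> S"
      using w by (simp add: x_def S_def)
    moreover have "A j x = A j s + A j w" for j
      using diff_point_diff[of \<delta> x "fst j" s] by (simp add: A_def x_def algebra_simps)
    then have "(\<Sum>j\<in>?K. c j * (g j \<bullet> A j x)) =
        (\<Sum>j\<in>?K. c j * (g j \<bullet> A j s)) + (\<Sum>j\<in>?K. c j * (g j \<bullet> A j w))"
      by (simp only: inner_add_right distrib_left sum.distrib)
    moreover have "R x = R s + R w"
      by (simp add: R_def L_def x_def inner_add_right distrib_left sum.distrib)
    ultimately have "0 \<le> R w + (\<Sum>j\<in>?K. c j * (g j \<bullet> A j w))"
      using g(2) by fastforce
    moreover have "(\<Sum>j\<in>?K. c j * (g j \<bullet> A j w)) =
        (\<Sum>i=0..N-2. (\<Sum>k=1..m. \<alpha> i k *\<^sub>R g (i, k)) \<bullet> diff_point \<delta> w i)"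
      by (simp add: c_def A_def inner_sum_left sum.cartesian_product case_prod_unfold)
    ultimately show ?thesis
      by (simp add: R_def L_def r_def)
  qed
  then show ?thesis
    using g(1) gq(1) by (intro exI[of _ "\<lambda>i k. g (i, k)"] bexI[of _ gq]) (auto simp: A_def)
qed

lemma mem_sum_scaled_sets_iff:
  fixes T :: "'k \<Rightarrow> 'e::real_vector set"
  assumes "finite A"
  shows "p \<in> (\<Sum>k\<in>A. (\<lambda>p. a k *\<^sub>R p) ` T k) \<longleftrightarrow>
    (\<exists>g. (\<forall>k\<in>A. g k \<in> T k) \<and> p = (\<Sum>k\<in>A. a k *\<^sub>R g k))"
proof
  assume "p \<in> (\<Sum>k\<in>A. (\<lambda>p. a k *\<^sub>R p) ` T k)"
  then obtain s where s: "p = sum s A" "\<forall>k\<in>A. s k \<in> (\<lambda>p. a k *\<^sub>R p) ` T k"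
    unfolding set_sum_alt[OF assms] by blast
  from s(2) have "\<forall>k\<in>A. \<exists>g. g \<in> T k \<and> s k = a k *\<^sub>R g"
    by blast
  then obtain g where "\<forall>k\<in>A. g k \<in> T k \<and> s k = a k *\<^sub>R g k"
    using bchoice[of A "\<lambda>k g. g \<in> T k \<and> s k = a k *\<^sub>R g"] by blast
  then show "\<exists>g. (\<forall>k\<in>A. g k \<in> T k) \<and> p = (\<Sum>k\<in>A. a k *\<^sub>R g k)"
    using s(1) by (intro exI[of _ g]) simp
next
  assume "\<exists>g. (\<forall>k\<in>A. g k \<in> T k) \<and> p = (\<Sum>k\<in>A. a k *\<^sub>R g k)"
  then show "p \<in> (\<Sum>k\<in>A. (\<lambda>p. a k *\<^sub>R p) ` T k)"
    unfolding set_sum_alt[OF assms] by blast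
qed

text \<open>A cost term can be infinite at an arbitrary trajectory; a single feasible trajectory of
  finite cost excludes this for an optimal one.\<close>

lemma pda_optimal_finite_cost:
  assumes \<delta>: "\<delta> > 0"
    and f: "\<And>i. i \<in> {2..N-2} \<Longrightarrow> proper_fun (\<lambda>x. f x i)"
    and z: "pda_feasible N \<delta> m W \<upsilon>0 \<upsilon>1 z" "\<And>i. i \<in> {2..N-2} \<Longrightarrow> \<bar>f (z i) i\<bar> \<noteq> \<infinity>"
    and optimal: "pda_optimal N \<delta> m W f q \<upsilon>0 \<upsilon>1 s"
    and i: "i \<in> {2..N-2}"
  shows "\<bar>f (s i) i\<bar> \<noteq> \<infinity>"
proof -
  have "pda_cost N \<delta> f q z \<noteq> \<infinity>"
    using pda_cost_finite[where x = z and f = f and N = N] z(2) by simp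
  moreover have "pda_cost N \<delta> f q s \<le> pda_cost N \<delta> f q z"
    using optimal z(1) by (simp add: pda_optimal_def)
  ultimately have "pda_cost N \<delta> f q s \<noteq> \<infinity>"
    by auto
  then have "f (s i) i \<noteq> \<infinity>"
    using pda_cost_infinite[OF \<delta> i] by blast
  moreover have "f (s i) i \<noteq> -\<infinity>"
    using f[OF i] by (simp add: proper_fun_def)
  ultimately show ?thesis
    by auto
qed

text \<open>The third component of the inclusion at \<open>i\<close> determines \<open>x\<^sup>*\<close> at \<open>i + 2\<close> and the second one
  determines \<open>u\<^sup>*\<close> at \<open>i + 1\<close>. The first component at \<open>i \<ge> 2\<close> and the boundary
  conditions are equations to be proved; at \<open>i = 0\<close> and \<open>i = 1\<close> it is solved for the free value of
  \<open>x\<^sup>*\<close>.\<close>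

lemma pda_optimal_imp_conditions:
  fixes W :: "nat \<Rightarrow> 'a::euclidean_space \<times> 'a \<times> 'a \<Rightarrow> real" and f :: "'a \<Rightarrow> nat \<Rightarrow> ereal"
  assumes N: "N \<ge> 2" and \<delta>: "\<delta> > 0"
    and W: "\<And>k. k \<in> {1..m} \<Longrightarrow> convex_on UNIV (W k)"
    and q: "convex_on UNIV q"
    and f: "\<And>i. i \<in> {2..N-2} \<Longrightarrow> proper_fun (\<lambda>x. f x i) \<and> convex_fun (\<lambda>x. f x i)"
    and f_convention: "\<And>x. f x 0 = 0" "\<And>x. f x 1 = 0"
    and gradient: "\<And>i. i \<in> {2..N-2} \<Longrightarrow> has_gradient (\<lambda>y. f y i) (s i) (f' i)"
    and optimal: "pda_optimal N \<delta> m W f q \<upsilon>0 \<upsilon>1 s"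
  shows "\<exists>\<mu>\<in>{0, 1}. \<exists>\<alpha> xs us.
    pda_nontrivial N m \<mu> \<alpha> xs us \<and> pda_conditions N \<delta> m W f q s \<mu> \<alpha> xs us"
proof -
  have finite_cost: "\<bar>f (s i) i\<bar> \<noteq> \<infinity>" if "i \<in> {2..N-2}" for i
    using gradient[OF that] interior_subset unfolding has_gradient_def by fastforce
  obtain \<mu> \<alpha> where \<mu>: "\<mu> \<in> {0, 1}"
    and \<alpha>: "\<forall>i\<in>{0..N-2}. \<forall>k\<in>{1..m}. 0 \<le> \<alpha> i k \<and> \<alpha> i k * W k (diff_point \<delta> s i) = 0"
    and nontrivial: "\<mu> \<noteq> 0 \<or> (\<exists>i\<in>{0..N-2}. \<exists>k\<in>{1..m}. \<alpha> i k \<noteq> 0)"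
    and minimal: "\<forall>x. x 0 = s 0 \<and> x 1 = s 1 \<and> (\<forall>i\<in>{2..N-2}. \<bar>f (x i) i\<bar> \<noteq> \<infinity>) \<longrightarrow>
      0 \<le> \<mu> * ((\<delta> * (\<Sum>i=2..N-2. real_of_ereal (f (x i) i)) + q (x (N - 1))) / \<delta>\<^sup>2 -
            (\<delta> * (\<Sum>i=2..N-2. real_of_ereal (f (s i) i)) + q (s (N - 1))) / \<delta>\<^sup>2) +
        (\<Sum>(i, k)\<in>{0..N-2} \<times> {1..m}. \<alpha> i k * W k (diff_point \<delta> x i))"
    using pda_fritz_john[OF \<delta> W q f finite_cost optimal] by blast
  have "\<exists>g. \<exists>gq\<in>subdifferential q (s (N - 1)).
    (\<forall>i\<in>{0..N-2}. \<forall>k\<in>{1..m}. g i k \<in> subdifferential (W k) (diff_point \<delta> s i)) \<and>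
    (\<forall>w. w 0 = 0 \<and> w 1 = 0 \<longrightarrow>
      0 \<le> \<mu> / \<delta> * (\<Sum>i=2..N-2. f' i \<bullet> w i) + \<mu> / \<delta>\<^sup>2 * (gq \<bullet> w (N - 1)) +
        (\<Sum>i=0..N-2. (\<Sum>k=1..m. \<alpha> i k *\<^sub>R g i k) \<bullet> diff_point \<delta> w i))"
    using \<mu> \<alpha> minimal by (intro pda_stationarity[OF \<delta> W q gradient]) auto
  then obtain g gq where gq: "gq \<in> subdifferential q (s (N - 1))"
    and g: "\<forall>i\<in>{0..N-2}. \<forall>k\<in>{1..m}. g i k \<in> subdifferential (W k) (diff_point \<delta> s i)"
    and stationary: "\<forall>w. w 0 = 0 \<and> w 1 = 0 \<longrightarrow>
      0 \<le> \<mu> / \<delta> * (\<Sum>i=2..N-2. f' i \<bullet> w i) + \<mu> / \<delta>\<^sup>2 * (gq \<bullet> w (N - 1)) +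
        (\<Sum>i=0..N-2. (\<Sum>k=1..m. \<alpha> i k *\<^sub>R g i k) \<bullet> diff_point \<delta> w i)"
    by blast
  define P where "P i = (\<Sum>k=1..m. \<alpha> i k *\<^sub>R g i k)" for i
  define X where "X i = - snd (snd (P (i - 2)))" for i
  define us where "us i = (if i = 0 then 0 else \<delta> *\<^sub>R fst (snd (P (i - 1))) + 2 *\<^sub>R X (i + 1))" for i
  \<comment> \<open>For \<open>N = 2\<close> there is no inclusion at \<open>i = 1\<close>, and \<open>xs 1\<close> is instead the value that the
    boundary condition prescribes.\<close>
  define xs where "xs i =
    (if 2 \<le> i then X i
     else if i = 1 \<and> N = 2 then us 1 + \<mu> *\<^sub>R gq
     else \<delta>\<^sup>2 *\<^sub>R fst (P i) + us i - us (i + 1) + X (i + 2))" for i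
  \<comment> \<open>The inclusion holds with \<open>c i\<close> in place of the gradient term; \<open>c i\<close> and \<open>e\<close> measure what
    remains to be shown.\<close>
  define c where "c i = xs i - us i + us (i + 1) - xs (i + 2) - \<delta>\<^sup>2 *\<^sub>R fst (P i)" for i
  have P_eq: "P i = ((1 / \<delta>\<^sup>2) *\<^sub>R (xs i - us i + us (i + 1) - xs (i + 2) - c i),
      (1 / \<delta>) *\<^sub>R (us (i + 1) - 2 *\<^sub>R xs (i + 2)), - xs (i + 2))" for i
    using \<delta> by (simp add: c_def us_def xs_def X_def prod_eq_iff)
  define e where "e = \<mu> *\<^sub>R gq + us (N - 1) - xs (N - 1)"
  have variation: "0 \<le> (\<Sum>i=2..N-2. ((\<mu> * \<delta>) *\<^sub>R f' i - c i) \<bullet> w i) + e \<bullet> w (N - 1) - xs N \<bullet> w N"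
    if w: "w 0 = 0" "w 1 = 0" for w
  proof -
    have "(\<Sum>i=0..N-2. P i \<bullet> diff_point \<delta> w i) = (1 / \<delta>\<^sup>2) *
        ((us (N - 1) - xs (N - 1)) \<bullet> w (N - 1) - xs N \<bullet> w N - (\<Sum>i=2..N-2. c i \<bullet> w i))"
      unfolding P_eq using \<delta> N w by (intro adjoint_identity) auto
    moreover have "0 \<le> \<mu> / \<delta> * (\<Sum>i=2..N-2. f' i \<bullet> w i) + \<mu> / \<delta>\<^sup>2 * (gq \<bullet> w (N - 1)) +
        (\<Sum>i=0..N-2. P i \<bullet> diff_point \<delta> w i)"
      unfolding P_def using stationary w by blast
    ultimately have
      "0 \<le> \<mu> / \<delta> * (\<Sum>i=2..N-2. f' i \<bullet> w i) + \<mu> / \<delta>\<^sup>2 * (gq \<bullet> w (N - 1)) + (1 / \<delta>\<^sup>2) *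
        ((us (N - 1) - xs (N - 1)) \<bullet> w (N - 1) - xs N \<bullet> w N - (\<Sum>i=2..N-2. c i \<bullet> w i))"
      by (simp only:)
    then have "0 \<le> \<delta>\<^sup>2 * (\<mu> / \<delta> * (\<Sum>i=2..N-2. f' i \<bullet> w i) + \<mu> / \<delta>\<^sup>2 * (gq \<bullet> w (N - 1)) + (1 / \<delta>\<^sup>2) *
        ((us (N - 1) - xs (N - 1)) \<bullet> w (N - 1) - xs N \<bullet> w N - (\<Sum>i=2..N-2. c i \<bullet> w i)))"
      by (rule mult_nonneg_nonneg[OF zero_le_power2])
    also have "\<delta>\<^sup>2 * (\<mu> / \<delta> * F + \<mu> / \<delta>\<^sup>2 * G + (1 / \<delta>\<^sup>2) * K) = \<mu> * \<delta> * F + \<mu> * G + K" for F G K :: real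
      using \<delta> by (simp add: field_simps power2_eq_square)
    finally have "0 \<le> \<mu> * \<delta> * (\<Sum>i=2..N-2. f' i \<bullet> w i) + \<mu> * (gq \<bullet> w (N - 1)) +
        ((us (N - 1) - xs (N - 1)) \<bullet> w (N - 1) - xs N \<bullet> w N - (\<Sum>i=2..N-2. c i \<bullet> w i))" .
    moreover have "(\<Sum>i=2..N-2. ((\<mu> * \<delta>) *\<^sub>R f' i - c i) \<bullet> w i) =
        \<mu> * \<delta> * (\<Sum>i=2..N-2. f' i \<bullet> w i) - (\<Sum>i=2..N-2. c i \<bullet> w i)"
      by (simp add: inner_diff_left sum_subtractf sum_distrib_left)
    moreover have "e \<bullet> w (N - 1) = \<mu> * (gq \<bullet> w (N - 1)) + (us (N - 1) - xs (N - 1)) \<bullet> w (N - 1)"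
      by (simp add: e_def inner_diff_left inner_add_left)
    ultimately show ?thesis
      by linarith
  qed
  define single where "single j v i = (if i = j then v else 0)" for j i :: nat and v :: 'a
  have vanish: "v = 0" if "0 \<le> v \<bullet> (- v)" for v :: 'a
  proof (rule ccontr)
    assume "v \<noteq> 0"
    then have "0 < v \<bullet> v"
      by simp
    with that show False
      unfolding inner_minus_right by linarith
  qed
  have xs_N: "xs N = 0"
  proof -
    have "(\<Sum>i=2..N-2. ((\<mu> * \<delta>) *\<^sub>R f' i - c i) \<bullet> single N (xs N) i) = 0"
      by (intro sum.neutral) (auto simp: single_def)
    moreover have "single N (xs N) (N - 1) = 0"
      using N by (auto simp: single_def)
    ultimately have "0 \<le> xs N \<bullet> (- xs N)"
      using variation[of "single N (xs N)"] N by (simp add: single_def)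
    then show ?thesis
      by (rule vanish)
  qed
  have e: "e = 0"
  proof (cases "N = 2")
    case True
    then show ?thesis
      by (simp add: e_def xs_def)
  next
    case False
    have "(\<Sum>i=2..N-2. ((\<mu> * \<delta>) *\<^sub>R f' i - c i) \<bullet> single (N - 1) (- e) i) = 0"
      using N False by (intro sum.neutral) (auto simp: single_def)
    moreover have "single (N - 1) (- e) N = 0" "single (N - 1) (- e) 0 = 0" "single (N - 1) (- e) 1 = 0"
      using N False by (auto simp: single_def)
    moreover have "single (N - 1) (- e) (N - 1) = - e"
      by (simp add: single_def)
    ultimately show ?thesis
      using variation[of "single (N - 1) (- e)"] by (intro vanish) simp
  qed
  have c: "c j = (\<mu> * \<delta>) *\<^sub>R f' j" if j: "j \<in> {2..N-2}" for j
  proof -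
    define d where "d = (\<mu> * \<delta>) *\<^sub>R f' j - c j"
    have "(\<Sum>i=2..N-2. ((\<mu> * \<delta>) *\<^sub>R f' i - c i) \<bullet> single j (- d) i) = d \<bullet> (- d)"
    proof -
      have "(\<Sum>i=2..N-2. ((\<mu> * \<delta>) *\<^sub>R f' i - c i) \<bullet> single j (- d) i) =
          (\<Sum>i=2..N-2. if i = j then d \<bullet> (- d) else 0)"
        by (intro sum.cong) (auto simp: single_def d_def)
      then show ?thesis
        using j by simp
    qed
    then have "0 \<le> d \<bullet> (- d)"
      using variation[of "single j (- d)"] j by (simp add: e xs_N) (auto simp: single_def)
    then have "d = 0"
      by (rule vanish)
    then show ?thesis
      by (simp add: d_def)
  qed
  have "pda_conditions N \<delta> m W f q s \<mu> \<alpha> xs us"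
    unfolding pda_conditions_def
  proof (intro conjI ballI)
    fix i assume i: "i \<in> {0..N-2}"
    show "\<exists>f'. has_gradient (\<lambda>y. f y i) (s i) f' \<and>
        ((1 / \<delta>\<^sup>2) *\<^sub>R (xs i - us i + us (i + 1) - xs (i + 2) - (\<mu> * \<delta>) *\<^sub>R f'),
          (1 / \<delta>) *\<^sub>R (us (i + 1) - 2 *\<^sub>R xs (i + 2)), - xs (i + 2))
        \<in> (\<Sum>k\<in>active_set m W (diff_point \<delta> s i).
            (\<lambda>p. \<alpha> i k *\<^sub>R p) ` subdifferential (W k) (diff_point \<delta> s i))"
    proof -
      have "\<exists>f'. has_gradient (\<lambda>y. f y i) (s i) f' \<and> c i = (\<mu> * \<delta>) *\<^sub>R f'"
      proof (cases "2 \<le> i")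
        case True
        then show ?thesis
          using gradient[of i] c[of i] i by auto
      next
        case False
        then have i01: "i = 0 \<or> i = 1"
          by auto
        then have "has_gradient (\<lambda>y. f y i) (s i) 0"
          using f_convention by (auto simp: has_gradient_def GDERIV_const)
        moreover have "\<not> (i = 1 \<and> N = 2)"
          using i by auto
        then have "c i = 0"
          using False by (auto simp: c_def xs_def)
        ultimately show ?thesis
          by auto
      qed
      then obtain fi where fi: "has_gradient (\<lambda>y. f y i) (s i) fi" "c i = (\<mu> * \<delta>) *\<^sub>R fi"
        by blast
      have fin: "finite (active_set m W (diff_point \<delta> s i))"
        by (simp add: active_set_def)
      have "P i = (\<Sum>k\<in>active_set m W (diff_point \<delta> s i). \<alpha> i k *\<^sub>R g i k)"
        unfolding P_def using \<alpha> i by (intro sum.mono_neutral_right) (auto simp: active_set_def)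
      moreover have "\<forall>k\<in>active_set m W (diff_point \<delta> s i). g i k \<in> subdifferential (W k) (diff_point \<delta> s i)"
        using g i by (auto simp: active_set_def)
      ultimately have "P i \<in> (\<Sum>k\<in>active_set m W (diff_point \<delta> s i).
          (\<lambda>p. \<alpha> i k *\<^sub>R p) ` subdifferential (W k) (diff_point \<delta> s i))"
        unfolding mem_sum_scaled_sets_iff[OF fin] by blast
      then show ?thesis
        using fi unfolding P_eq by auto
    qed
  next
    show "xs (N - 1) - us (N - 1) \<in> (\<lambda>p. \<mu> *\<^sub>R p) ` subdifferential q (s (N - 1))"
    proof (rule image_eqI[OF _ gq])
      show "xs (N - 1) - us (N - 1) = \<mu> *\<^sub>R gq"
        using e unfolding e_def by (simp add: algebra_simps)
    qed
  qed (use \<alpha> xs_N in auto)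
  moreover have "pda_nontrivial N m \<mu> \<alpha> xs us"
    using nontrivial by (auto simp: pda_nontrivial_def)
  ultimately show ?thesis
    using \<mu> by blast
qed

section \<open>Sufficiency\<close>

lemma pda_conditions_imp_optimal:
  fixes W :: "nat \<Rightarrow> 'a::euclidean_space \<times> 'a \<times> 'a \<Rightarrow> real" and f :: "'a \<Rightarrow> nat \<Rightarrow> ereal"
  assumes N: "N \<ge> 2" and \<delta>: "\<delta> > 0"
    and f: "\<And>i. i \<in> {2..N-2} \<Longrightarrow> proper_fun (\<lambda>x. f x i) \<and> convex_fun (\<lambda>x. f x i)"
    and feasible: "pda_feasible N \<delta> m W \<upsilon>0 \<upsilon>1 s"
    and conditions: "pda_conditions N \<delta> m W f q s 1 \<alpha> xs us"
  shows "pda_optimal N \<delta> m W f q \<upsilon>0 \<upsilon>1 s"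
  unfolding pda_optimal_def
proof (intro conjI allI impI)
  fix y assume y: "pda_feasible N \<delta> m W \<upsilon>0 \<upsilon>1 y"
  show "pda_cost N \<delta> f q s \<le> pda_cost N \<delta> f q y"
  proof (cases "\<exists>i\<in>{2..N-2}. f (y i) i = \<infinity>")
    case True
    then show ?thesis
      using pda_cost_infinite[OF \<delta>] by fastforce
  next
    case False
    have fin_y: "\<bar>f (y i) i\<bar> \<noteq> \<infinity>" if "i \<in> {2..N-2}" for i
      using False f[OF that] that by (auto simp: proper_fun_def)
    define p where "p f' i = ((1 / \<delta>\<^sup>2) *\<^sub>R (xs i - us i + us (i + 1) - xs (i + 2) - (1 * \<delta>) *\<^sub>R f'),
        (1 / \<delta>) *\<^sub>R (us (i + 1) - 2 *\<^sub>R xs (i + 2)), - xs (i + 2))" for f' :: 'a and i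
    have "\<forall>i\<in>{0..N-2}. \<exists>f'. has_gradient (\<lambda>y. f y i) (s i) f' \<and>
        p f' i \<in> (\<Sum>k\<in>active_set m W (diff_point \<delta> s i).
            (\<lambda>p. \<alpha> i k *\<^sub>R p) ` subdifferential (W k) (diff_point \<delta> s i))"
      using conditions by (auto simp: pda_conditions_def p_def)
    from bchoice[OF this] obtain f' where f': "\<forall>i\<in>{0..N-2}. has_gradient (\<lambda>y. f y i) (s i) (f' i) \<and>
        p (f' i) i \<in> (\<Sum>k\<in>active_set m W (diff_point \<delta> s i).
            (\<lambda>p. \<alpha> i k *\<^sub>R p) ` subdifferential (W k) (diff_point \<delta> s i))"
      by blast
    have \<alpha>: "\<alpha> i k \<ge> 0" if "i \<in> {0..N-2}" "k \<in> {1..m}" for i k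
      using conditions that by (auto simp: pda_conditions_def)
    obtain gq where gq: "gq \<in> subdifferential q (s (N - 1))" "xs (N - 1) - us (N - 1) = gq"
      using conditions by (auto simp: pda_conditions_def)
    have xs_N: "xs N = 0"
      using conditions by (auto simp: pda_conditions_def)
    have fin_s: "\<bar>f (s i) i\<bar> \<noteq> \<infinity>" if "i \<in> {2..N-2}" for i
      using f' that interior_subset unfolding has_gradient_def by fastforce
    define w where "w i = y i - s i" for i
    have w: "w 0 = 0" "w 1 = 0"
      using feasible y \<delta> by (auto simp: w_def pda_feasible_def diff1_0_eq_iff)
    have "p (f' i) i \<bullet> diff_point \<delta> w i \<le> 0" if i: "i \<in> {0..N-2}" for i
    proof -
      let ?A = "active_set m W (diff_point \<delta> s i)"
      have "finite ?A"
        by (simp add: active_set_def)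
      from bspec[OF f' i, THEN conjunct2, unfolded mem_sum_scaled_sets_iff[OF this]]
      obtain g where g: "\<forall>k\<in>?A. g k \<in> subdifferential (W k) (diff_point \<delta> s i)"
        "p (f' i) i = (\<Sum>k\<in>?A. \<alpha> i k *\<^sub>R g k)"
        by blast
      have "\<alpha> i k * (g k \<bullet> diff_point \<delta> w i) \<le> 0" if k: "k \<in> ?A" for k
      proof -
        have "W k (diff_point \<delta> s i) + g k \<bullet> (diff_point \<delta> y i - diff_point \<delta> s i) \<le> W k (diff_point \<delta> y i)"
          using g(1) k unfolding subdifferential_def by blast
        moreover have "W k (diff_point \<delta> s i) = 0" "k \<in> {1..m}"
          using k by (auto simp: active_set_def)
        moreover from this have "W k (diff_point \<delta> y i) \<le> 0"
          using y i by (auto simp: pda_feasible_def)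
        ultimately show ?thesis
          using \<alpha>[OF i] unfolding diff_point_diff w_def by (intro mult_nonneg_nonpos) auto
      qed
      then show ?thesis
        unfolding g(2) inner_sum_left inner_scaleR_left by (intro sum_nonpos) simp
    qed
    then have "(\<Sum>i=0..N-2. p (f' i) i \<bullet> diff_point \<delta> w i) \<le> 0"
      by (intro sum_nonpos) auto
    moreover have "(\<Sum>i=0..N-2. p (f' i) i \<bullet> diff_point \<delta> w i) = (1 / \<delta>\<^sup>2) *
        ((us (N - 1) - xs (N - 1)) \<bullet> w (N - 1) - xs N \<bullet> w N - (\<Sum>i=2..N-2. ((1 * \<delta>) *\<^sub>R f' i) \<bullet> w i))"
      unfolding p_def using \<delta> N w by (intro adjoint_identity) auto
    ultimately have
      "(us (N - 1) - xs (N - 1)) \<bullet> w (N - 1) - xs N \<bullet> w N - (\<Sum>i=2..N-2. ((1 * \<delta>) *\<^sub>R f' i) \<bullet> w i) \<le> 0"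
      using \<delta> by (simp add: divide_le_0_iff)
    moreover have "us (N - 1) - xs (N - 1) = - gq"
      using gq(2) by (simp flip: gq(2))
    ultimately have "0 \<le> gq \<bullet> w (N - 1) + \<delta> * (\<Sum>i=2..N-2. f' i \<bullet> w i)"
      by (simp add: xs_N sum_distrib_left)
    moreover have "\<delta> * (\<Sum>i=2..N-2. f' i \<bullet> w i) \<le>
        \<delta> * ((\<Sum>i=2..N-2. real_of_ereal (f (y i) i)) - (\<Sum>i=2..N-2. real_of_ereal (f (s i) i)))"
    proof -
      have "f' i \<bullet> w i \<le> real_of_ereal (f (y i) i) - real_of_ereal (f (s i) i)" if "i \<in> {2..N-2}" for i
        using convex_fun_gradient_inequality[of "\<lambda>x. f x i" "s i" "f' i" "y i"] f[OF that] f' fin_y[OF that] that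
        by (simp add: w_def)
      then show ?thesis
        unfolding sum_subtractf[symmetric] using \<delta> by (intro mult_left_mono sum_mono) auto
    qed
    moreover have "gq \<bullet> w (N - 1) \<le> q (y (N - 1)) - q (s (N - 1))"
    proof -
      have "q (s (N - 1)) + gq \<bullet> (y (N - 1) - s (N - 1)) \<le> q (y (N - 1))"
        using gq(1) unfolding subdifferential_def by blast
      then show ?thesis
        by (simp add: w_def)
    qed
    ultimately have "\<delta> * (\<Sum>i=2..N-2. real_of_ereal (f (s i) i)) + q (s (N - 1)) \<le>
        \<delta> * (\<Sum>i=2..N-2. real_of_ereal (f (y i) i)) + q (y (N - 1))"
      unfolding right_diff_distrib by linarith
    then show ?thesis
      using pda_cost_finite[where x = s and N = N and f = f] pda_cost_finite[where x = y and N = N and f = f]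
        fin_s fin_y by simp
  qed
qed (rule feasible)

section \<open>The optimality criterion\<close>

theorem theorem4p1:
  fixes N m :: nat and \<delta> :: real
    and W :: "nat \<Rightarrow> (real^'n) \<times> (real^'n) \<times> (real^'n) \<Rightarrow> real"
    and q :: "real^'n \<Rightarrow> real"
    and f :: "real^'n \<Rightarrow> nat \<Rightarrow> ereal"
    and \<upsilon>0 \<upsilon>1 :: "real^'n"
    and xt :: "nat \<Rightarrow> real^'n"
  assumes grid: "N \<ge> 2" "\<delta> > 0" "real N * \<delta> = 1"
    and W: "\<And>k. k \<in> {1..m} \<Longrightarrow> continuous_on UNIV (W k) \<and> convex_on UNIV (W k)"
    and q: "continuous_on UNIV q" "convex_on UNIV q"
    and f: "\<And>i. i \<in> {2..N-2} \<Longrightarrow>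
          proper_fun (\<lambda>x. f x i) \<and> convex_fun (\<lambda>x. f x i) \<and>
          continuously_differentiable (\<lambda>x. f x i)"
    and f_convention: "\<And>x. f x 0 = 0" "\<And>x. f x 1 = 0"
    and f_cont: "\<exists>x. pda_feasible N \<delta> m W \<upsilon>0 \<upsilon>1 x \<and>
          (\<forall>i\<in>{2..N-2}. continuous_at_pt (\<lambda>y. f y i) (x i))"
    and feasible: "pda_feasible N \<delta> m W \<upsilon>0 \<upsilon>1 xt"
  shows "(pda_optimal N \<delta> m W f q \<upsilon>0 \<upsilon>1 xt \<longrightarrow>
           (\<exists>\<mu>\<in>{0, 1}. \<exists>\<alpha> xs us.
              pda_nontrivial N m \<mu> \<alpha> xs us \<and> pda_conditions N \<delta> m W f q xt \<mu> \<alpha> xs us))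
       \<and> (pda_nondegenerate N \<delta> m W f \<longrightarrow>
           (\<exists>\<alpha> xs us. pda_conditions N \<delta> m W f q xt 1 \<alpha> xs us) \<longrightarrow>
           pda_optimal N \<delta> m W f q \<upsilon>0 \<upsilon>1 xt)"
proof (intro conjI impI)
  assume optimal: "pda_optimal N \<delta> m W f q \<upsilon>0 \<upsilon>1 xt"
  obtain z where z: "pda_feasible N \<delta> m W \<upsilon>0 \<upsilon>1 z" "\<forall>i\<in>{2..N-2}. continuous_at_pt (\<lambda>y. f y i) (z i)"
    using f_cont by blast
  have fin: "\<bar>f (xt i) i\<bar> \<noteq> \<infinity>" if "i \<in> {2..N-2}" for i
    by (rule pda_optimal_finite_cost[OF grid(2) _ z(1) _ optimal that])
      (use f z(2) in \<open>auto simp: continuous_at_pt_def\<close>)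
  have "\<exists>g. has_gradient (\<lambda>y. f y i) (xt i) g" if i: "i \<in> {2..N-2}" for i
  proof -
    have "xt i \<in> effective_domain (\<lambda>y. f y i)"
      using fin[OF i] by (auto simp: effective_domain_def)
    then show ?thesis
      using f[OF i] unfolding continuously_differentiable_def by blast
  qed
  then have "\<forall>i\<in>{2..N-2}. \<exists>g. has_gradient (\<lambda>y. f y i) (xt i) g"
    by blast
  from bchoice[OF this] obtain f' where "\<forall>i\<in>{2..N-2}. has_gradient (\<lambda>y. f y i) (xt i) (f' i)"
    by blast
  then show "\<exists>\<mu>\<in>{0, 1}. \<exists>\<alpha> xs us.
      pda_nontrivial N m \<mu> \<alpha> xs us \<and> pda_conditions N \<delta> m W f q xt \<mu> \<alpha> xs us"
    using W q f f_convention
    by (intro pda_optimal_imp_conditions[OF grid(1,2) _ _ _ _ _ _ optimal]) auto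
next
  assume "\<exists>\<alpha> xs us. pda_conditions N \<delta> m W f q xt 1 \<alpha> xs us"
  then show "pda_optimal N \<delta> m W f q \<upsilon>0 \<upsilon>1 xt"
    using pda_conditions_imp_optimal[OF grid(1,2) _ feasible] f by blast
qed

end
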